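(* Let $E=E(0,\infty)$ be a fully symmetric Banach space on the semi-axis $(0,\infty)$. For every given $0\le x\in E$, there exists a fully symmetric linear functional $\varphi:E\to\mathbb{R}$ such that $$\varphi(x)=\lim_{m\to\infty}\frac1m\|\sigma_m(\mu(x))\|_E.$$
   Context: For a measurable function $x$ on $(0,\infty)$, $\mu(t,x)=\inf\{s\ge0:\ |\{|x|>s\}|\le t\}$ (Lebesgue measure) is its decreasing rearrangement; $y\prec\prec x$ means $\int_0^t\mu(s,y)ds\le\int_0^t\mu(s,x)ds$ for all $t\ge0$. A fully symmetric Banach space $E$ on $(0,\infty)$ is a Banach space of (real-valued) functions $E\subset(L_1+L_\infty)(0,\infty)$ such that $x\in E$, $y\in L_1+L_\infty$ and $y\prec\prec x$ imply $y\in E$ and $\|y\|_E\le\|x\|_E$. The dilation operator is $(\sigma_mx)(t)=x(t/m)$, $t>0$. A linear functional $\varphi$ on $E$ is fully symmetric if $\varphi(y)\le\varphi(x)$ for all $0\le x,y\in E$ with $y\prec\prec x$. *)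

theory Defs
  imports "HOL-Analysis.Analysis"
begin

text \<open>
  A function on \<open>(0,\<infinity>)\<close> is represented by some \<open>x :: real \<Rightarrow> real\<close>; its values on \<open>(-\<infinity>,0]\<close> are
  irrelevant. Function spaces consist of representatives rather than of classes modulo
  almost everywhere equality, so they are closed under changes on null sets, and a norm
  vanishes exactly on the functions that are zero almost everywhere.
\<close>

abbreviation semiaxis :: "real measure" where
  "semiaxis \<equiv> lebesgue_on {0<..}"

text \<open>
  For \<open>x \<in> L\<^sub>1 + L\<^sub>\<infinity>\<close> and \<open>t > 0\<close> the set below is nonempty and the infimum is the usual one. For
  \<open>t = 0\<close> and unbounded \<open>x\<close> the rearrangement would be infinite and the value is unspecified;
  this single point is never relevant.
\<close>

definition rearrangement :: "(real \<Rightarrow> real) \<Rightarrow> real \<Rightarrow> real" where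
  "rearrangement x t =
     Inf {s. 0 \<le> s \<and> emeasure semiaxis {u \<in> {0<..}. \<bar>x u\<bar> > s} \<le> ennreal t}"

definition L1_plus_Linf :: "(real \<Rightarrow> real) set" where
  "L1_plus_Linf =
     {x. \<exists>f g. integrable semiaxis f \<and>
           g \<in> borel_measurable semiaxis \<and> (\<exists>C. AE u in semiaxis. \<bar>g u\<bar> \<le> C) \<and>
           (\<forall>u>0. x u = f u + g u)}"

definition submajorized :: "(real \<Rightarrow> real) \<Rightarrow> (real \<Rightarrow> real) \<Rightarrow> bool"
    (infix \<open>\<prec>\<prec>\<close> 50) where
  "y \<prec>\<prec> x \<longleftrightarrow>
     (\<forall>t\<ge>0. (\<integral>\<^sup>+s\<in>{0<..<t}. ennreal (rearrangement y s) \<partial>lborel)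
           \<le> (\<integral>\<^sup>+s\<in>{0<..<t}. ennreal (rearrangement x s) \<partial>lborel))"

definition dilation :: "real \<Rightarrow> (real \<Rightarrow> real) \<Rightarrow> real \<Rightarrow> real" where
  "dilation m x t = x (t / m)"

definition banach_function_space ::
    "(real \<Rightarrow> real) set \<Rightarrow> ((real \<Rightarrow> real) \<Rightarrow> real) \<Rightarrow> bool" where
  "banach_function_space E N \<longleftrightarrow>
     E \<subseteq> L1_plus_Linf \<and>
     (\<forall>x\<in>E. \<forall>y. (AE u in semiaxis. y u = x u) \<longrightarrow> y \<in> E) \<and>
     (\<lambda>u. 0) \<in> E \<and>
     (\<forall>x\<in>E. \<forall>y\<in>E. (\<lambda>u. x u + y u) \<in> E) \<and>
     (\<forall>c. \<forall>x\<in>E. (\<lambda>u. c * x u) \<in> E) \<and>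
     (\<forall>x\<in>E. N x \<ge> 0) \<and>
     (\<forall>x\<in>E. N x = 0 \<longleftrightarrow> (AE u in semiaxis. x u = 0)) \<and>
     (\<forall>c. \<forall>x\<in>E. N (\<lambda>u. c * x u) = \<bar>c\<bar> * N x) \<and>
     (\<forall>x\<in>E. \<forall>y\<in>E. N (\<lambda>u. x u + y u) \<le> N x + N y) \<and>
     (\<forall>X. (\<forall>n. X n \<in> E) \<and>
          (\<forall>e>0. \<exists>K::nat. \<forall>m\<ge>K. \<forall>n\<ge>K. N (\<lambda>u. X m u - X n u) < e) \<longrightarrow>
          (\<exists>x\<in>E. (\<lambda>n. N (\<lambda>u. X n u - x u)) \<longlonglongrightarrow> 0))"

definition fully_symmetric_space ::
    "(real \<Rightarrow> real) set \<Rightarrow> ((real \<Rightarrow> real) \<Rightarrow> real) \<Rightarrow> bool" where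
  "fully_symmetric_space E N \<longleftrightarrow>
     banach_function_space E N \<and>
     (\<forall>x\<in>E. \<forall>y\<in>L1_plus_Linf. y \<prec>\<prec> x \<longrightarrow> y \<in> E \<and> N y \<le> N x)"

text \<open>The first conjunct makes the functional well defined on classes of functions.\<close>

definition linear_functional_on ::
    "(real \<Rightarrow> real) set \<Rightarrow> ((real \<Rightarrow> real) \<Rightarrow> real) \<Rightarrow> bool" where
  "linear_functional_on E \<phi> \<longleftrightarrow>
     (\<forall>x\<in>E. \<forall>y\<in>E. (AE u in semiaxis. x u = y u) \<longrightarrow> \<phi> x = \<phi> y) \<and>
     (\<forall>x\<in>E. \<forall>y\<in>E. \<phi> (\<lambda>u. x u + y u) = \<phi> x + \<phi> y) \<and>
     (\<forall>c. \<forall>x\<in>E. \<phi> (\<lambda>u. c * x u) = c * \<phi> x)"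

definition fully_symmetric_functional ::
    "(real \<Rightarrow> real) set \<Rightarrow> ((real \<Rightarrow> real) \<Rightarrow> real) \<Rightarrow> bool" where
  "fully_symmetric_functional E \<phi> \<longleftrightarrow>
     linear_functional_on E \<phi> \<and>
     (\<forall>x\<in>E. \<forall>y\<in>E. (AE u in semiaxis. 0 \<le> x u) \<longrightarrow> (AE u in semiaxis. 0 \<le> y u) \<longrightarrow>
        y \<prec>\<prec> x \<longrightarrow> \<phi> y \<le> \<phi> x)"

end

theory Submission
  imports Defs
begin

text \<open>
  Write \<open>F x t\<close> for the integral of \<open>\<mu>(x)\<close> over \<open>(0,t)\<close> (\<open>partial_integral\<close> below), so that
  \<open>y \<prec>\<prec> x\<close> means \<open>F y \<le> F x\<close>, and \<open>D\<^sub>m x = (1/m) \<sigma>\<^sub>m \<mu>(x)\<close> (\<open>contraction\<close>), so that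
  \<open>F (D\<^sub>m x) t = F x (t/m)\<close>. The norms of \<open>D\<^sub>m x\<close> decrease in \<open>m\<close>, and their limit has to be the value of a
  fully symmetric functional at \<open>x\<close>. By the Hahn-Banach theorem it is enough to find a sublinear functional
  \<open>q\<close> on \<open>E\<close> that takes this value at \<open>x\<close> and for which \<open>q (y - z) \<le> 0\<close> whenever \<open>0 \<le> y, z\<close> and
  \<open>y \<prec>\<prec> z\<close>: a linear \<open>\<phi> \<le> q\<close> with \<open>\<phi> x = q x\<close> is then as required.
  
  Let \<open>q z\<close> be the infimum of the norms of all \<open>a \<ge> 0\<close> in \<open>E\<close> that dominate \<open>z\<close> in the sense that
  \<open>F (z + v) t \<le> F v (L t) + F a (L t)\<close> for some \<open>v \<ge> 0\<close> in \<open>E\<close> with \<open>z + v \<ge> 0\<close> and some natural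
  number \<open>L\<close>, for all \<open>t\<close>. If \<open>y \<prec>\<prec> z\<close>, then \<open>y - z\<close> is dominated by zero, with \<open>v = z\<close>. Sublinearity
  follows from the two inequalities
  \<open>F (x + y) t \<le> F x t + F y t\<close> and, for \<open>x, y \<ge> 0\<close>, \<open>F x s + F y t \<le> F (x + y) (s + t)\<close>. Both are
  immediate from the formula \<open>F x t = min {t r + \<integral>(\<bar>x\<bar> - r)\<^sup>+ | r \<ge> 0}\<close>.
  
  The point is that \<open>q x\<close> is not smaller than the limit of the norms of \<open>D\<^sub>m x\<close>. If \<open>a\<close> dominates
  \<open>x \<ge> 0\<close>, then for \<open>M = 2 L\<close>
  \<open>F x t + F v t \<le> F (x + v) (2 t) \<le> F v (M t) + F a (M t)\<close>.
  Summing this over the points \<open>t/M, \<dots>, t/M\<^sup>k\<close> makes the terms in \<open>v\<close> telescope and leaves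
  \<open>k F x (t/M\<^sup>k) \<le> F v t + k F a t \<le> F (v + k a) (2 t)\<close>.
  Hence \<open>k D\<^sub>m x \<prec>\<prec> v + k a\<close> for \<open>m = 2 M\<^sup>k\<close>, the norm of \<open>D\<^sub>m x\<close> is at most that of \<open>a\<close> plus a \<open>k\<close>-th
  of that of \<open>v\<close>, and letting \<open>k\<close> grow removes \<open>v\<close>.
\<close>

section \<open>The Hahn-Banach theorem for spaces of functions\<close>

text \<open>
  The operations are written out pointwise because this is the form in which the operations of the
  space \<open>E\<close> are given.
\<close>

definition function_space :: "('b \<Rightarrow> real) set \<Rightarrow> bool" where
  "function_space V \<longleftrightarrow> (\<lambda>u. 0) \<in> V \<and> (\<forall>x\<in>V. \<forall>y\<in>V. (\<lambda>u. x u + y u) \<in> V) \<and>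
     (\<forall>c. \<forall>x\<in>V. (\<lambda>u. c * x u) \<in> V)"

text \<open>
  Asking only for \<open>\<le>\<close> in the homogeneity law is equivalent to equality on a
  function space: apply it to \<open>1/c\<close> as well.
\<close>

definition sublinear_on :: "('b \<Rightarrow> real) set \<Rightarrow> (('b \<Rightarrow> real) \<Rightarrow> real) \<Rightarrow> bool" where
  "sublinear_on V p \<longleftrightarrow> (\<forall>x\<in>V. \<forall>y\<in>V. p (\<lambda>u. x u + y u) \<le> p x + p y) \<and>
     (\<forall>c\<ge>0. \<forall>x\<in>V. p (\<lambda>u. c * x u) \<le> c * p x)"

lemma function_spaceD:
  assumes "function_space V"
  shows "(\<lambda>u. 0) \<in> V" "x \<in> V \<Longrightarrow> y \<in> V \<Longrightarrow> (\<lambda>u. x u + y u) \<in> V" "x \<in> V \<Longrightarrow> (\<lambda>u. c * x u) \<in> V"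
  using assms unfolding function_space_def by auto

lemma sublinear_onD:
  assumes "sublinear_on V p"
  shows "x \<in> V \<Longrightarrow> y \<in> V \<Longrightarrow> p (\<lambda>u. x u + y u) \<le> p x + p y"
    "0 \<le> c \<Longrightarrow> x \<in> V \<Longrightarrow> p (\<lambda>u. c * x u) \<le> c * p x"
  using assms unfolding sublinear_on_def by auto

lemma sublinear_zero:
  assumes V: "function_space V" and p: "sublinear_on V p"
  shows "p (\<lambda>u. 0) = 0"
proof -
  note z = function_spaceD(1)[OF V]
  have "p (\<lambda>u. 0) \<le> 0" using sublinear_onD(2)[OF p _ z, of 0] by simp
  moreover have "p (\<lambda>u. 0) \<le> p (\<lambda>u. 0) + p (\<lambda>u. 0)" using sublinear_onD(1)[OF p z z] by simp
  ultimately show ?thesis by linarith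
qed

lemma sublinear_ge_neg:
  assumes V: "function_space V" and p: "sublinear_on V p" and x: "x \<in> V"
  shows "- p (\<lambda>u. - 1 * x u) \<le> p x"
proof -
  have "p (\<lambda>u. x u + - 1 * x u) \<le> p x + p (\<lambda>u. - 1 * x u)"
    by (intro sublinear_onD(1)[OF p] x function_spaceD(3)[OF V])
  then show ?thesis using sublinear_zero[OF V p] by simp
qed

text \<open>
  The functional \<open>p' x = inf {p (x + t y) - t p y | t \<ge> 0}\<close> is the largest sublinear one below
  \<open>p\<close> with \<open>p' (- y) \<le> - p y\<close>. The second inequality is the case \<open>t = 1\<close>. It serves twice: applied
  to a minimal \<open>p\<close> it forces additivity, and applied to the given \<open>q\<close> it fixes the value of
  the functional at a prescribed point.
\<close>

lemma sublinear_le_along: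
  assumes V: "function_space V" and p: "sublinear_on V p" and y: "y \<in> V"
  obtains p' where "sublinear_on V p'" "\<And>x. x \<in> V \<Longrightarrow> p' x \<le> p x"
    "\<And>x. x \<in> V \<Longrightarrow> p' x \<le> p (\<lambda>u. x u + y u) - p y"
proof -
  define S where "S x = {p (\<lambda>u. x u + t * y u) - t * p y | t. 0 \<le> t}" for x
  define p' where "p' x = Inf (S x)" for x
  note sp = function_spaceD[OF V]
  have bdd: "bdd_below (S x)" if x: "x \<in> V" for x
  proof (rule bdd_belowI)
    fix s assume "s \<in> S x"
    then obtain t where t: "0 \<le> t" "s = p (\<lambda>u. x u + t * y u) - t * p y" unfolding S_def by auto
    have ty: "t * p y \<le> p (\<lambda>u. t * y u)"
    proof (cases "t = 0")
      case True then show ?thesis using sublinear_zero[OF V p] by simp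
    next
      case False
      have "p (\<lambda>u. (1/t) * (t * y u)) \<le> (1/t) * p (\<lambda>u. t * y u)"
        using t by (intro sublinear_onD(2)[OF p] sp y) auto
      then show ?thesis using False t by (simp add: field_simps)
    qed
    have "p (\<lambda>u. (x u + t * y u) + - 1 * x u) \<le> p (\<lambda>u. x u + t * y u) + p (\<lambda>u. - 1 * x u)"
      by (intro sublinear_onD(1)[OF p] sp x y)
    then show "- p (\<lambda>u. - 1 * x u) \<le> s" using ty t by (simp add: algebra_simps)
  qed
  have low: "p' x \<le> p (\<lambda>u. x u + t * y u) - t * p y" if "x \<in> V" "0 \<le> t" for x t
    unfolding p'_def by (rule cInf_lower[OF _ bdd[OF that(1)]]) (use that in \<open>auto simp: S_def\<close>)
  have great: "b \<le> p' x" if "x \<in> V" "\<And>t. 0 \<le> t \<Longrightarrow> b \<le> p (\<lambda>u. x u + t * y u) - t * p y" for b x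
    unfolding p'_def by (rule cInf_greatest) (use that in \<open>auto simp: S_def intro: exI[of _ 0]\<close>)
  have "sublinear_on V p'"
    unfolding sublinear_on_def
  proof (intro conjI ballI allI impI)
    fix x x' assume x: "x \<in> V" "x' \<in> V"
    have "p' (\<lambda>u. x u + x' u) - (p (\<lambda>u. x' u + s * y u) - s * p y) \<le> p (\<lambda>u. x u + t * y u) - t * p y"
      if "0 \<le> t" "0 \<le> s" for s t
    proof -
      have "p' (\<lambda>u. x u + x' u) \<le> p (\<lambda>u. (x u + x' u) + (t + s) * y u) - (t + s) * p y"
        using that by (intro low sp x) auto
      also have "(\<lambda>u. (x u + x' u) + (t + s) * y u) = (\<lambda>u. (x u + t * y u) + (x' u + s * y u))"
        by (auto simp: algebra_simps)
      also have "p \<dots> \<le> p (\<lambda>u. x u + t * y u) + p (\<lambda>u. x' u + s * y u)"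
        by (intro sublinear_onD(1)[OF p] sp x y)
      finally show ?thesis by (simp add: algebra_simps)
    qed
    then have "p' (\<lambda>u. x u + x' u) - (p (\<lambda>u. x' u + s * y u) - s * p y) \<le> p' x" if "0 \<le> s" for s
      using that by (intro great x) auto
    then have "p' (\<lambda>u. x u + x' u) - p' x \<le> p (\<lambda>u. x' u + s * y u) - s * p y" if "0 \<le> s" for s
      using that by (simp add: algebra_simps)
    then have "p' (\<lambda>u. x u + x' u) - p' x \<le> p' x'" by (intro great x) auto
    then show "p' (\<lambda>u. x u + x' u) \<le> p' x + p' x'" by simp
  next
    fix c :: real and x assume c: "0 \<le> c" and x: "x \<in> V"
    show "p' (\<lambda>u. c * x u) \<le> c * p' x"
    proof (cases "c = 0")
      case True
      have "p' (\<lambda>u. c * x u) \<le> p (\<lambda>u. c * x u + 0 * y u) - 0 * p y" by (intro low sp x) auto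
      then show ?thesis using True sublinear_zero[OF V p] by simp
    next
      case False
      then have c: "c > 0" using c by simp
      have "p' (\<lambda>u. c * x u) / c \<le> p (\<lambda>u. x u + t * y u) - t * p y" if t: "0 \<le> t" for t
      proof -
        have "p' (\<lambda>u. c * x u) \<le> p (\<lambda>u. c * x u + (c * t) * y u) - (c * t) * p y"
          using t c by (intro low sp x) auto
        also have "(\<lambda>u. c * x u + (c * t) * y u) = (\<lambda>u. c * (x u + t * y u))"
          by (auto simp: algebra_simps)
        also have "p \<dots> \<le> c * p (\<lambda>u. x u + t * y u)"
          using c by (intro sublinear_onD(2)[OF p] sp x y) auto
        finally show ?thesis using c by (simp add: field_simps)
      qed
      then have "p' (\<lambda>u. c * x u) / c \<le> p' x" by (intro great x)
      then show ?thesis using c by (simp add: field_simps)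
    qed
  qed
  moreover have "p' x \<le> p x" if "x \<in> V" for x using low[OF that, of 0] by simp
  moreover have "p' x \<le> p (\<lambda>u. x u + y u) - p y" if "x \<in> V" for x using low[OF that, of 1] by simp
  ultimately show thesis using that by blast
qed

text \<open>
  Zorn's lemma for the reverse pointwise order. A chain has its pointwise infimum as a lower bound;
  the infimum is finite because \<open>- q (- x) \<le> - p (- x) \<le> p x\<close>, and subadditive because two members of
  the chain can always be replaced by the smaller of them.
\<close>

lemma minimal_sublinear:
  assumes V: "function_space V" and q: "sublinear_on V q"
  obtains m where "sublinear_on V m" "\<And>x. x \<in> V \<Longrightarrow> m x \<le> q x"
    "\<And>p x. sublinear_on V p \<Longrightarrow> (\<And>x. x \<in> V \<Longrightarrow> p x \<le> m x) \<Longrightarrow> x \<in> V \<Longrightarrow> p x = m x"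
proof -
  (* Values off V are normalised to 0, which makes the pointwise order antisymmetric. *)
  define A where "A = {p. sublinear_on V p \<and> (\<forall>x\<in>V. p x \<le> q x) \<and> (\<forall>x. x \<notin> V \<longrightarrow> p x = 0)}"
  define P where "P a b \<longleftrightarrow> (\<forall>x. b x \<le> a x)" for a b :: "('a \<Rightarrow> real) \<Rightarrow> real"
  note sp = function_spaceD[OF V]
  have norm: "(\<lambda>x. if x \<in> V then p x else 0) \<in> A" if "sublinear_on V p" "\<And>x. x \<in> V \<Longrightarrow> p x \<le> q x" for p
    using that sp unfolding A_def sublinear_on_def by auto
  have "\<exists>m\<in>A. \<forall>a\<in>A. P m a \<longrightarrow> a = m"
  proof (rule predicate_Zorn)
    show "partial_order_on A (relation_of P A)"
      by (rule partial_order_on_relation_ofI) (auto simp: P_def fun_eq_iff intro: order.trans order.antisym)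
  next
    fix C assume C: "C \<in> Chains (relation_of P A)"
    have CA: "p \<in> A" if "p \<in> C" for p using C that unfolding Chains_def relation_of_def by auto
    have tot: "P p r \<or> P r p" if "p \<in> C" "r \<in> C" for p r
      using C that unfolding Chains_def relation_of_def by auto
    show "\<exists>u\<in>A. \<forall>a\<in>C. P a u"
    proof (cases "C = {}")
      case True
      then show ?thesis using norm[OF q] by blast
    next
      case False
      define i where "i x = Inf ((\<lambda>p. p x) ` C)" for x
      have sub: "sublinear_on V p" and leq: "\<And>x. x \<in> V \<Longrightarrow> p x \<le> q x" if "p \<in> C" for p
        using CA[OF that] unfolding A_def by auto
      have bdd: "bdd_below ((\<lambda>p. p x) ` C)" if x: "x \<in> V" for x
      proof (rule bdd_belowI2)
        fix p assume p: "p \<in> C"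
        have "p (\<lambda>u. - 1 * x u) \<le> q (\<lambda>u. - 1 * x u)" by (intro leq p sp x)
        then show "- q (\<lambda>u. - 1 * x u) \<le> p x" using sublinear_ge_neg[OF V sub[OF p] x] by linarith
      qed
      have low: "i x \<le> p x" if "p \<in> C" "x \<in> V" for p x
        unfolding i_def using that by (intro cInf_lower bdd) auto
      have great: "b \<le> i x" if "\<And>p. p \<in> C \<Longrightarrow> b \<le> p x" for b x
        unfolding i_def using that False by (intro cInf_greatest) auto
      have "sublinear_on V i"
        unfolding sublinear_on_def
      proof (intro conjI ballI allI impI)
        fix x y assume xy: "x \<in> V" "y \<in> V"
        have "i (\<lambda>u. x u + y u) - r y \<le> p x" if pr: "p \<in> C" "r \<in> C" for p r
        proof -
          have "\<exists>s\<in>C. s x \<le> p x \<and> s y \<le> r y"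
            using tot[OF pr] pr unfolding P_def by blast
          then obtain s where s: "s \<in> C" "s x \<le> p x" "s y \<le> r y" by blast
          have "i (\<lambda>u. x u + y u) \<le> s (\<lambda>u. x u + y u)" by (intro low s sp xy)
          also have "\<dots> \<le> s x + s y" by (rule sublinear_onD(1)[OF sub[OF s(1)] xy])
          finally show ?thesis using s by linarith
        qed
        then have "i (\<lambda>u. x u + y u) - r y \<le> i x" if "r \<in> C" for r using that by (intro great)
        then have "i (\<lambda>u. x u + y u) - i x \<le> i y" by (intro great) (simp add: algebra_simps)
        then show "i (\<lambda>u. x u + y u) \<le> i x + i y" by simp
      next
        fix c :: real and x assume c: "0 \<le> c" and x: "x \<in> V"
        have a: "i (\<lambda>u. c * x u) \<le> c * p x" if "p \<in> C" for p
          using low[OF that sp(3)[OF x], of c] sublinear_onD(2)[OF sub[OF that] c x] by linarith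
        show "i (\<lambda>u. c * x u) \<le> c * i x"
        proof (cases "c = 0")
          case True then show ?thesis using a False by fastforce
        next
          case False
          then have "i (\<lambda>u. c * x u) / c \<le> i x"
            using a c by (intro great) (simp add: field_simps)
          then show ?thesis using False c by (simp add: field_simps)
        qed
      qed
      moreover have "i x \<le> q x" if "x \<in> V" for x
      proof -
        obtain p where "p \<in> C" using False by blast
        from low[OF this that] leq[OF this that] show ?thesis by (rule order.trans)
      qed
      ultimately have "(\<lambda>x. if x \<in> V then i x else 0) \<in> A" by (rule norm)
      moreover have "P p (\<lambda>x. if x \<in> V then i x else 0)" if "p \<in> C" for p
        using low[OF that] CA[OF that] unfolding P_def A_def by auto
      ultimately show ?thesis by blast
    qed
  qed
  then obtain m where m: "m \<in> A" "\<And>a. a \<in> A \<Longrightarrow> P m a \<Longrightarrow> a = m" by blast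
  show thesis
  proof (rule that)
    show "sublinear_on V m" "\<And>x. x \<in> V \<Longrightarrow> m x \<le> q x" using m(1) unfolding A_def by auto
  next
    fix p x assume p: "sublinear_on V p" "\<And>x. x \<in> V \<Longrightarrow> p x \<le> m x" and x: "x \<in> V"
    have "(\<lambda>x. if x \<in> V then p x else 0) \<in> A"
      using p(2) m(1) by (intro norm p(1)) (auto simp: A_def intro: order.trans)
    moreover have "P m (\<lambda>x. if x \<in> V then p x else 0)"
      using p(2) m(1) unfolding P_def A_def by auto
    ultimately have "(\<lambda>x. if x \<in> V then p x else 0) = m" by (rule m(2))
    from fun_cong[OF this, of x] show "p x = m x" using x by simp
  qed
qed

text \<open>
  A minimal sublinear functional is linear: by minimality it cannot be lowered along any \<open>y\<close>, which
  is the missing inequality \<open>m x + m y \<le> m (x + y)\<close>. Starting from \<open>q\<close> lowered along \<open>x0\<close> gives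
  \<open>\<phi> (- x0) \<le> - q x0\<close> and hence \<open>\<phi> x0 = q x0\<close>.
\<close>

lemma hahn_banach_sublinear:
  assumes V: "function_space V" and q: "sublinear_on V q" and x0: "x0 \<in> V"
  obtains \<phi> where "\<And>x y. x \<in> V \<Longrightarrow> y \<in> V \<Longrightarrow> \<phi> (\<lambda>u. x u + y u) = \<phi> x + \<phi> y"
    "\<And>c x. x \<in> V \<Longrightarrow> \<phi> (\<lambda>u. c * x u) = c * \<phi> x"
    "\<And>x. x \<in> V \<Longrightarrow> \<phi> x \<le> q x" "\<phi> x0 = q x0"
proof -
  note sp = function_spaceD[OF V]
  obtain q' where q': "sublinear_on V q'" "\<And>x. x \<in> V \<Longrightarrow> q' x \<le> q x"
    "\<And>x. x \<in> V \<Longrightarrow> q' x \<le> q (\<lambda>u. x u + x0 u) - q x0"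
    using sublinear_le_along[OF V q x0] by blast
  obtain m where m: "sublinear_on V m" "\<And>x. x \<in> V \<Longrightarrow> m x \<le> q' x"
    and min: "\<And>p x. sublinear_on V p \<Longrightarrow> (\<And>x. x \<in> V \<Longrightarrow> p x \<le> m x) \<Longrightarrow> x \<in> V \<Longrightarrow> p x = m x"
    using minimal_sublinear[OF V q'(1)] by blast
  have add: "m (\<lambda>u. x u + y u) = m x + m y" if xy: "x \<in> V" "y \<in> V" for x y
  proof -
    obtain p where p: "sublinear_on V p" "\<And>x. x \<in> V \<Longrightarrow> p x \<le> m x"
      "\<And>x. x \<in> V \<Longrightarrow> p x \<le> m (\<lambda>u. x u + y u) - m y"
      using sublinear_le_along[OF V m(1) xy(2)] by blast
    have "m x \<le> m (\<lambda>u. x u + y u) - m y" using p(3)[OF xy(1)] min[OF p(1,2) xy(1)] by simp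
    then show ?thesis using sublinear_onD(1)[OF m(1) xy] by linarith
  qed
  have neg: "m (\<lambda>u. - 1 * x u) = - m x" if x: "x \<in> V" for x
    using add[OF x sp(3)[OF x], of "- 1"] sublinear_zero[OF V m(1)] by simp
  have pos: "m (\<lambda>u. c * x u) = c * m x" if c: "0 \<le> c" and x: "x \<in> V" for c x
  proof -
    have "m (\<lambda>u. c * (- 1 * x u)) \<le> c * m (\<lambda>u. - 1 * x u)"
      by (intro sublinear_onD(2)[OF m(1)] sp c x)
    moreover have "(\<lambda>u. c * (- 1 * x u)) = (\<lambda>u. - 1 * (c * x u))" by auto
    ultimately have "c * m x \<le> m (\<lambda>u. c * x u)"
      using neg[OF x] neg[OF sp(3)[OF x], of c] by simp
    then show ?thesis using sublinear_onD(2)[OF m(1) c x] by linarith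
  qed
  have hom: "m (\<lambda>u. c * x u) = c * m x" if x: "x \<in> V" for c x
  proof (cases "0 \<le> c")
    case False
    have "m (\<lambda>u. - 1 * ((- c) * x u)) = - m (\<lambda>u. (- c) * x u)" by (rule neg[OF sp(3)[OF x]])
    then show ?thesis using pos[OF _ x, of "- c"] False by simp
  qed (use pos x in auto)
  have "m (\<lambda>u. - 1 * x0 u) \<le> q (\<lambda>u. - 1 * x0 u + x0 u) - q x0"
    by (rule order.trans[OF m(2) q'(3)]; intro sp x0)
  then have "q x0 \<le> m x0" using neg[OF x0] sublinear_zero[OF V q] by simp
  moreover have le: "m x \<le> q x" if "x \<in> V" for x by (rule order.trans[OF m(2)[OF that] q'(2)[OF that]])
  ultimately have "m x0 = q x0" using le[OF x0] by linarith
  then show thesis using that[of m] add hom le by blast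
qed

section \<open>Partial integrals of the decreasing rearrangement\<close>

definition partial_integral :: "(real \<Rightarrow> real) \<Rightarrow> real \<Rightarrow> ennreal" where
  "partial_integral x t = (\<integral>\<^sup>+s\<in>{0<..<t}. ennreal (rearrangement x s) \<partial>lborel)"

text \<open>
  As \<open>r\<close> varies, \<open>t r + excess x r\<close> are the upper bounds for \<open>partial_integral x t\<close> that the
  decomposition of \<open>x\<close> by truncation at level \<open>r\<close> provides; the best of them is sharp.
\<close>

definition excess :: "(real \<Rightarrow> real) \<Rightarrow> real \<Rightarrow> ennreal" where
  "excess x r = (\<integral>\<^sup>+u. ennreal (\<bar>x u\<bar> - r) \<partial>semiaxis)"

lemma sigma_finite_semiaxis: "sigma_finite_measure semiaxis"
proof (rule sigma_finite_measure_restrict_space)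
  obtain A :: "real set set" where "countable A" "A \<subseteq> sets lborel" "\<Union>A = space lborel"
    "\<forall>a\<in>A. emeasure lborel a \<noteq> \<infinity>"
    using lborel.sigma_finite_countable by blast
  then show "sigma_finite_measure (lebesgue :: real measure)"
    unfolding sigma_finite_measure_def by (intro exI[of _ A]) auto
qed simp

lemma nn_integral_semiaxis:
  "(\<integral>\<^sup>+u. f u \<partial>semiaxis) = (\<integral>\<^sup>+u\<in>{0<..}. f u \<partial>lborel)"
  by (simp add: nn_integral_restrict_space nn_integral_completion)

lemma emeasure_lborel_Ioi: "emeasure lborel {r::real<..} = \<infinity>"
proof -
  have "of_nat n \<le> emeasure lborel {r<..}" for n
  proof -
    have "of_nat n = emeasure lborel {r<..<r + real n}" by (simp add: ennreal_of_nat_eq_real_of_nat)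
    also have "\<dots> \<le> emeasure lborel {r<..}" by (rule emeasure_mono) auto
    finally show ?thesis .
  qed
  then show ?thesis by (metis ennreal_Ex_less_of_nat infinity_ennreal_def less_top not_le)
qed

lemma excess_layer_cake:
  assumes [measurable]: "x \<in> borel_measurable semiaxis"
  shows "excess x r = (\<integral>\<^sup>+s\<in>{r..}. emeasure semiaxis {u\<in>{0<..}. s < \<bar>x u\<bar>} \<partial>lborel)"
proof -
  interpret semi: sigma_finite_measure semiaxis by (rule sigma_finite_semiaxis)
  interpret pair_sigma_finite semiaxis "lborel :: real measure" ..
  have "excess x r = (\<integral>\<^sup>+u. \<integral>\<^sup>+s. indicator {p. r \<le> snd p \<and> snd p < \<bar>x (fst p)\<bar>} (u, s) \<partial>lborel \<partial>semiaxis)"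
    unfolding excess_def
  proof (rule nn_integral_cong)
    fix u
    have "ennreal (\<bar>x u\<bar> - r) = emeasure lborel {r..<\<bar>x u\<bar>}"
      by (cases "r \<le> \<bar>x u\<bar>") (auto simp: ennreal_neg)
    also have "\<dots> = (\<integral>\<^sup>+s. indicator {r..<\<bar>x u\<bar>} s \<partial>lborel)" by simp
    also have "\<dots> = (\<integral>\<^sup>+s. indicator {p. r \<le> snd p \<and> snd p < \<bar>x (fst p)\<bar>} (u, s) \<partial>lborel)"
      by (intro nn_integral_cong) (auto split: split_indicator)
    finally show "ennreal (\<bar>x u\<bar> - r) = \<dots>" .
  qed
  also have "\<dots> = (\<integral>\<^sup>+s. \<integral>\<^sup>+u. indicator {p. r \<le> snd p \<and> snd p < \<bar>x (fst p)\<bar>} (u, s) \<partial>semiaxis \<partial>lborel)"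
    by (rule Fubini'[symmetric]) measurable
  also have "\<dots> = (\<integral>\<^sup>+s\<in>{r..}. emeasure semiaxis {u\<in>{0<..}. s < \<bar>x u\<bar>} \<partial>lborel)"
  proof (rule nn_integral_cong)
    fix s
    have [measurable]: "{u\<in>{0<..}. s < \<bar>x u\<bar>} \<in> sets semiaxis"
    proof -
      have "{u\<in>space semiaxis. s < \<bar>x u\<bar>} \<in> sets semiaxis" by measurable
      then show ?thesis by simp
    qed
    define U where "U = {u\<in>{0<..}. s < \<bar>x u\<bar>}"
    have U: "U \<in> sets semiaxis" unfolding U_def by measurable
    have "(\<integral>\<^sup>+u. indicator {p. r \<le> snd p \<and> snd p < \<bar>x (fst p)\<bar>} (u, s) \<partial>semiaxis)
        = (\<integral>\<^sup>+u. indicator {r..} s * indicator U u \<partial>semiaxis)"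
      by (intro nn_integral_cong) (auto simp: U_def split: split_indicator)
    then show "(\<integral>\<^sup>+u. indicator {p. r \<le> snd p \<and> snd p < \<bar>x (fst p)\<bar>} (u, s) \<partial>semiaxis)
        = emeasure semiaxis {u\<in>{0<..}. s < \<bar>x u\<bar>} * indicator {r..} s"
      unfolding nn_integral_cmult_indicator[OF U] U_def[symmetric] by (simp add: mult.commute)
  qed
  finally show ?thesis .
qed

lemma L1_plus_Linf_measurable:
  assumes "x \<in> L1_plus_Linf"
  shows "x \<in> borel_measurable semiaxis"
proof -
  from assms obtain f g where fg: "integrable semiaxis f" "g \<in> borel_measurable semiaxis"
    "\<forall>u>0. x u = f u + g u" unfolding L1_plus_Linf_def by auto
  have "(\<lambda>u. f u + g u) \<in> borel_measurable semiaxis" using fg by measurable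
  then show ?thesis using fg(3) by (subst measurable_cong[where g="\<lambda>u. f u + g u"]) auto
qed

lemma L1_plus_Linf_excess_finite:
  assumes "x \<in> L1_plus_Linf"
  obtains r where "0 \<le> r" "excess x r < \<infinity>"
proof -
  from assms obtain f g C where fg: "integrable semiaxis f" "g \<in> borel_measurable semiaxis"
    "AE u in semiaxis. \<bar>g u\<bar> \<le> C" "\<forall>u>0. x u = f u + g u" unfolding L1_plus_Linf_def by auto
  have "AE u in semiaxis. 0 < u" by (rule AE_I2) simp
  with fg(3) have "AE u in semiaxis. ennreal (\<bar>x u\<bar> - max 0 C) \<le> ennreal (norm (f u))"
    by eventually_elim (use fg(4) in \<open>auto intro!: ennreal_leI\<close>)
  then have "excess x (max 0 C) \<le> (\<integral>\<^sup>+u. ennreal (norm (f u)) \<partial>semiaxis)"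
    unfolding excess_def by (rule nn_integral_mono_AE)
  also have "\<dots> < \<infinity>" using fg(1) by (simp add: integrable_iff_bounded)
  finally show ?thesis using that[of "max 0 C"] by simp
qed

text \<open>
  The set whose infimum defines the rearrangement is nonempty: were the distribution function
  above \<open>t > 0\<close> at every level, its integral, the excess, would be infinite.
\<close>

lemma distribution_finite:
  assumes x: "x \<in> borel_measurable semiaxis" and r: "excess x r < \<infinity>" and t: "0 < t"
  shows "\<exists>s\<ge>r. emeasure semiaxis {u\<in>{0<..}. s < \<bar>x u\<bar>} \<le> ennreal t"
proof (rule ccontr)
  assume "\<not> ?thesis"
  then have "ennreal t < emeasure semiaxis {u\<in>{0<..}. s < \<bar>x u\<bar>}" if "r \<le> s" for s
    using that by (meson not_le)
  then have "ennreal t * indicator {r..} s \<le> emeasure semiaxis {u\<in>{0<..}. s < \<bar>x u\<bar>} * indicator {r..} s" for s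
    by (cases "r \<le> s") (simp_all add: less_imp_le)
  then have "(\<integral>\<^sup>+s. ennreal t * indicator {r..} s \<partial>lborel) \<le> excess x r"
    unfolding excess_layer_cake[OF x] by (intro nn_integral_mono) auto
  moreover have "emeasure lborel {r..} = \<infinity>"
    using emeasure_mono[of "{r<..}" "{r..}" lborel] by (simp add: emeasure_lborel_Ioi top_unique greaterThan_subset_iff subset_eq)
  then have "(\<integral>\<^sup>+s. ennreal t * indicator {r..} s \<partial>lborel) = \<infinity>"
    using t by (simp add: nn_integral_cmult_indicator ennreal_mult_eq_top_iff)
  ultimately show False using r by simp
qed

text \<open>
  The rearrangement and the distribution function are generalised inverses of each other. The
  strict form of the equivalence rests on right continuity of the distribution function, that is, on
  continuity of the measure from below.
\<close>

lemma less_rearrangement_iff: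
  assumes x: "x \<in> L1_plus_Linf" and t: "0 < t" and r: "0 \<le> r"
  shows "r < rearrangement x t \<longleftrightarrow> ennreal t < emeasure semiaxis {u\<in>{0<..}. r < \<bar>x u\<bar>}"
proof -
  define d where "d s = emeasure semiaxis {u\<in>{0<..}. s < \<bar>x u\<bar>}" for s
  define S where "S = {s. 0 \<le> s \<and> d s \<le> ennreal t}"
  have [measurable]: "x \<in> borel_measurable semiaxis" by (rule L1_plus_Linf_measurable[OF x])
  have sets: "{u\<in>{0<..}. s < \<bar>x u\<bar>} \<in> sets semiaxis" for s
  proof -
    have "{u\<in>space semiaxis. s < \<bar>x u\<bar>} \<in> sets semiaxis" by measurable
    then show ?thesis by simp
  qed
  have mu: "rearrangement x t = Inf S" unfolding rearrangement_def S_def d_def ..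
  have anti: "d s' \<le> d s" if "s \<le> s'" for s s'
    unfolding d_def using that by (intro emeasure_mono sets) auto
  obtain r1 where r1: "0 \<le> r1" "excess x r1 < \<infinity>" by (rule L1_plus_Linf_excess_finite[OF x])
  obtain s1 where s1: "s1 \<ge> r1" "d s1 \<le> ennreal t"
    using distribution_finite[OF L1_plus_Linf_measurable[OF x] r1(2) t] unfolding d_def by blast
  with r1 have ne: "S \<noteq> {}" unfolding S_def by force
  have bdd: "bdd_below S" unfolding S_def by (rule bdd_belowI[of _ 0]) auto
  show ?thesis
    unfolding d_def[symmetric]
  proof (rule iffI; rule ccontr)
    assume "r < rearrangement x t" "\<not> ennreal t < d r"
    then have "r \<in> S" using r by (auto simp: S_def)
    then have "rearrangement x t \<le> r" unfolding mu by (rule cInf_lower[OF _ bdd])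
    then show False using \<open>r < rearrangement x t\<close> by simp
  next
    assume a: "ennreal t < d r" "\<not> r < rearrangement x t"
    have "d (r + 1 / Suc n) \<le> ennreal t" for n
    proof -
      have "0 < 1 / real (Suc n)" by simp
      then have "Inf S < r + 1 / Suc n" using a(2) unfolding mu by linarith
      then obtain s where "s \<in> S" "s < r + 1 / Suc n" using cInf_less_iff[OF ne bdd] by blast
      then show ?thesis using anti[of s "r + 1 / Suc n"] by (auto simp: S_def)
    qed
    moreover have "d r = (SUP n. d (r + 1 / Suc n))"
    proof -
      have "{u\<in>{0<..}. r < \<bar>x u\<bar>} = (\<Union>n. {u\<in>{0<..}. r + 1 / Suc n < \<bar>x u\<bar>})"
      proof safe
        fix u assume "r < \<bar>x u\<bar>" "0 < u"
        then obtain n where "inverse (real (Suc n)) < \<bar>x u\<bar> - r"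
          using reals_Archimedean[of "\<bar>x u\<bar> - r"] by auto
        then show "u \<in> (\<Union>n. {u\<in>{0<..}. r + 1 / Suc n < \<bar>x u\<bar>})"
          using \<open>0 < u\<close> by (intro UN_I[of n]) (simp_all add: inverse_eq_divide)
      next
        fix u n assume "r + 1 / real (Suc n) < \<bar>x u\<bar>"
        moreover have "0 < 1 / real (Suc n)" by simp
        ultimately show "r < \<bar>x u\<bar>" by linarith
      qed
      moreover have "incseq (\<lambda>n. {u\<in>{0<..}. r + 1 / Suc n < \<bar>x u\<bar>})"
      proof (rule incseq_SucI, safe)
        fix n u assume "r + 1 / real (Suc n) < \<bar>x u\<bar>"
        moreover have "1 / real (Suc (Suc n)) \<le> 1 / real (Suc n)" by (rule divide_left_mono) auto
        ultimately show "r + 1 / real (Suc (Suc n)) < \<bar>x u\<bar>" by linarith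
      qed
      then have "(SUP n. d (r + 1 / Suc n)) = emeasure semiaxis (\<Union>n. {u\<in>{0<..}. r + 1 / Suc n < \<bar>x u\<bar>})"
        unfolding d_def by (rule SUP_emeasure_incseq[rotated]) (rule image_subsetI, rule sets)
      ultimately show ?thesis unfolding d_def by simp
    qed
    ultimately have "d r \<le> ennreal t" by (simp add: SUP_le_iff)
    then show False using a(1) by simp
  qed
qed

lemma rearrangement_nonneg:
  assumes "x \<in> L1_plus_Linf" "0 < t"
  shows "0 \<le> rearrangement x t"
proof -
  obtain r where r: "0 \<le> r" "excess x r < \<infinity>" by (rule L1_plus_Linf_excess_finite[OF assms(1)])
  obtain s where "s \<ge> r" "emeasure semiaxis {u\<in>{0<..}. s < \<bar>x u\<bar>} \<le> ennreal t"
    using distribution_finite[OF L1_plus_Linf_measurable[OF assms(1)] r(2) assms(2)] by blast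
  with r have "s \<in> {s. 0 \<le> s \<and> emeasure semiaxis {u\<in>{0<..}. s < \<bar>x u\<bar>} \<le> ennreal t}" by simp
  then show ?thesis unfolding rearrangement_def by (intro cInf_greatest) blast+
qed

lemma rearrangement_antimono:
  assumes x: "x \<in> L1_plus_Linf" and st: "0 < s" "s \<le> t"
  shows "rearrangement x t \<le> rearrangement x s"
proof (rule ccontr)
  assume a: "\<not> ?thesis"
  have 0: "0 \<le> rearrangement x s" by (rule rearrangement_nonneg[OF x st(1)])
  have "ennreal t < emeasure semiaxis {u\<in>{0<..}. rearrangement x s < \<bar>x u\<bar>}"
    using less_rearrangement_iff[OF x _ 0, of t] a st by simp
  moreover have "\<not> ennreal s < emeasure semiaxis {u\<in>{0<..}. rearrangement x s < \<bar>x u\<bar>}"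
    using less_rearrangement_iff[OF x st(1) 0] by simp
  ultimately show False using st ennreal_leI[of s t] by (meson le_less_trans)
qed

text \<open>
  Together with \<open>less_rearrangement_iff\<close> this says that a function and its rearrangement are
  equimeasurable.
\<close>

lemma emeasure_semiaxis_below:
  "emeasure semiaxis {s\<in>{0<..}. ennreal s < c} = c"
proof (cases c)
  case (real k)
  then have "{s\<in>{0<..}. ennreal s < c} = {0<..<k}" by (auto simp: ennreal_less_iff)
  then have "emeasure semiaxis {s\<in>{0<..}. ennreal s < c} = emeasure lebesgue {0<..<k}"
    by (simp only:) (subst emeasure_restrict_space, auto)
  then show ?thesis using real by simp
next
  case top
  then have "{s\<in>{0<..}. ennreal s < c} = {0<..}" by auto
  then have "emeasure semiaxis {s\<in>{0<..}. ennreal s < c} = emeasure lebesgue {0::real<..}"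
    by (simp only:) (subst emeasure_restrict_space, auto)
  then show ?thesis using top by (simp add: emeasure_lborel_Ioi)
qed

lemma antimono_measurable:
  fixes g :: "real \<Rightarrow> real"
  assumes "\<And>s t. 0 < s \<Longrightarrow> s \<le> t \<Longrightarrow> g t \<le> g s"
  shows "g \<in> borel_measurable (restrict_space borel {0<..})" "g \<in> borel_measurable semiaxis"
proof -
  have "(\<lambda>t. - g t) \<in> borel_measurable (restrict_space borel {0<..})"
    using assms by (intro borel_measurable_mono_on_fnc mono_onI) auto
  then have "(\<lambda>t. - (- g t)) \<in> borel_measurable (restrict_space borel {0<..})" by (rule borel_measurable_uminus)
  then show 1: "g \<in> borel_measurable (restrict_space borel {0<..})" by simp
  have "g \<in> borel_measurable (restrict_space lborel {0<..})"
    using 1 by (simp add: measurable_cong_sets[OF sets_restrict_space_cong[OF sets_lborel]])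
  then show "g \<in> borel_measurable semiaxis"
    by (simp add: borel_measurable_restrict_space_iff measurable_completion)
qed

lemma excess_rearrangement:
  assumes x: "x \<in> L1_plus_Linf" and r: "0 \<le> r"
  shows "excess (rearrangement x) r = excess x r"
proof -
  have "emeasure semiaxis {u\<in>{0<..}. s < \<bar>rearrangement x u\<bar>} = emeasure semiaxis {u\<in>{0<..}. s < \<bar>x u\<bar>}"
    if "r \<le> s" for s
  proof -
    have "{u\<in>{0<..}. s < \<bar>rearrangement x u\<bar>}
        = {u\<in>{0<..}. ennreal u < emeasure semiaxis {u\<in>{0<..}. s < \<bar>x u\<bar>}}"
      using less_rearrangement_iff[OF x] rearrangement_nonneg[OF x] r that by auto
    then show ?thesis by (simp only: emeasure_semiaxis_below)
  qed
  moreover have m: "rearrangement x \<in> borel_measurable semiaxis"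
    by (rule antimono_measurable(2)[OF rearrangement_antimono[OF x]])
  ultimately show ?thesis
    unfolding excess_layer_cake[OF L1_plus_Linf_measurable[OF x]] excess_layer_cake[OF m]
    by (intro nn_integral_cong) (auto split: split_indicator)
qed

text \<open>
  Pointwise \<open>g \<le> r + (g - r)\<^sup>+\<close>. For nonincreasing \<open>g\<close> and \<open>r = g t\<close> this is an equality on
  \<open>(0,t)\<close> while the positive part vanishes beyond \<open>t\<close>, so nothing is lost.
\<close>

lemma integral_le_excess:
  assumes g: "\<And>s. 0 < s \<Longrightarrow> 0 \<le> g s" "\<And>s t. 0 < s \<Longrightarrow> s \<le> t \<Longrightarrow> g t \<le> g s"
    and r: "0 \<le> r" and t: "0 \<le> t"
  shows "(\<integral>\<^sup>+s\<in>{0<..<t}. ennreal (g s) \<partial>lborel) \<le> ennreal (t * r) + excess g r"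
    and "0 < t \<Longrightarrow> r = g t \<Longrightarrow>
      (\<integral>\<^sup>+s\<in>{0<..<t}. ennreal (g s) \<partial>lborel) = ennreal (t * r) + excess g r"
proof -
  note gm = antimono_measurable(1)[of g, OF g(2)]
  have m: "(\<lambda>s. ennreal (\<bar>g s\<bar> - r) * indicator {0<..} s) \<in> borel_measurable lborel"
  proof -
    have "(\<lambda>s. ennreal (\<bar>g s\<bar> - r)) \<in> borel_measurable (restrict_space borel {0<..})" using gm by measurable
    then show ?thesis by (subst (asm) borel_measurable_restrict_space_iff_ennreal) auto
  qed
  have tr: "ennreal (t * r) = (\<integral>\<^sup>+s. ennreal r * indicator {0<..<t} s \<partial>lborel)"
    using r t by (simp add: nn_integral_cmult_indicator ennreal_mult mult.commute)
  have sum: "ennreal (t * r) + excess g r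
      = (\<integral>\<^sup>+s. ennreal r * indicator {0<..<t} s + ennreal (\<bar>g s\<bar> - r) * indicator {0<..} s \<partial>lborel)"
    unfolding excess_def nn_integral_semiaxis tr by (rule nn_integral_add[symmetric]) (use m in auto)
  show "(\<integral>\<^sup>+s\<in>{0<..<t}. ennreal (g s) \<partial>lborel) \<le> ennreal (t * r) + excess g r"
    unfolding sum
  proof (intro nn_integral_mono)
    fix s
    have "ennreal (g s) \<le> ennreal r + ennreal (\<bar>g s\<bar> - r)" if "0 < s"
      using g(1)[OF that] r by (cases "r \<le> g s") (auto simp: ennreal_neg ennreal_leI simp flip: ennreal_plus)
    then show "ennreal (g s) * indicator {0<..<t} s
        \<le> ennreal r * indicator {0<..<t} s + ennreal (\<bar>g s\<bar> - r) * indicator {0<..} s"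
      by (auto split: split_indicator)
  qed
  show "(\<integral>\<^sup>+s\<in>{0<..<t}. ennreal (g s) \<partial>lborel) = ennreal (t * r) + excess g r" if "0 < t" "r = g t"
    unfolding sum
  proof (intro nn_integral_cong)
    fix s
    have "ennreal (g s) = ennreal r + ennreal (\<bar>g s\<bar> - r)" if "0 < s" "s < t"
      using g(1)[of s] g(2)[of s t] r that \<open>r = g t\<close> by (auto simp flip: ennreal_plus)
    moreover have "ennreal (\<bar>g s\<bar> - r) = 0" if "t \<le> s"
      using g(1)[of s] g(2)[of t s] that \<open>r = g t\<close> \<open>0 < t\<close> by (simp add: ennreal_neg)
    ultimately show "ennreal (g s) * indicator {0<..<t} s
        = ennreal r * indicator {0<..<t} s + ennreal (\<bar>g s\<bar> - r) * indicator {0<..} s"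
      by (auto split: split_indicator)
  qed
qed

text \<open>
  The next two lemmas are the variational formula
  \<open>partial_integral x t = min {t r + excess x r | r \<ge> 0}\<close>. It expresses the partial integrals without
  the rearrangement, and every inequality between them below is deduced from a pointwise inequality
  for positive parts.
\<close>

lemma partial_integral_le_excess:
  assumes x: "x \<in> L1_plus_Linf" and "0 \<le> r" "0 \<le> t"
  shows "partial_integral x t \<le> ennreal (t * r) + excess x r"
  unfolding partial_integral_def excess_rearrangement[OF assms(1,2), symmetric]
  by (rule integral_le_excess(1)) (use assms rearrangement_nonneg[OF x] rearrangement_antimono[OF x] in auto)

lemma partial_integral_excess_attained:
  assumes x: "x \<in> L1_plus_Linf" and t: "0 < t"
  obtains r where "0 \<le> r" "partial_integral x t = ennreal (t * r) + excess x r"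
proof
  show r: "0 \<le> rearrangement x t" by (rule rearrangement_nonneg[OF x t])
  show "partial_integral x t = ennreal (t * rearrangement x t) + excess x (rearrangement x t)"
    unfolding partial_integral_def excess_rearrangement[OF x r, symmetric]
    by (rule integral_le_excess(2)) (use r t rearrangement_nonneg[OF x] rearrangement_antimono[OF x] in auto)
qed

lemma partial_integral_nonpos: "t \<le> 0 \<Longrightarrow> partial_integral x t = 0"
  unfolding partial_integral_def by simp

lemma partial_integral_mono: "s \<le> t \<Longrightarrow> partial_integral x s \<le> partial_integral x t"
  unfolding partial_integral_def by (intro nn_integral_mono) (auto split: split_indicator)

lemma partial_integral_finite:
  assumes x: "x \<in> L1_plus_Linf"
  shows "partial_integral x t < \<infinity>"
proof (cases "0 \<le> t")
  case True
  obtain r where r: "0 \<le> r" "excess x r < \<infinity>" by (rule L1_plus_Linf_excess_finite[OF x])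
  have "partial_integral x t \<le> ennreal (t * r) + excess x r"
    by (rule partial_integral_le_excess[OF x r(1) True])
  also have "\<dots> < \<infinity>" using r by simp
  finally show ?thesis .
qed (simp add: partial_integral_nonpos)

text \<open>
  Truncation levels add: \<open>(\<bar>x + y\<bar> - (r + r'))\<^sup>+ \<le> (\<bar>x\<bar> - r)\<^sup>+ + (\<bar>y\<bar> - r')\<^sup>+\<close>.
\<close>

lemma partial_integral_add_le:
  assumes x: "x \<in> L1_plus_Linf" and y: "y \<in> L1_plus_Linf" and z: "(\<lambda>u. x u + y u) \<in> L1_plus_Linf"
  shows "partial_integral (\<lambda>u. x u + y u) t \<le> partial_integral x t + partial_integral y t"
proof (cases "0 < t")
  case t: True
  note [measurable] = L1_plus_Linf_measurable[OF x] L1_plus_Linf_measurable[OF y]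
  obtain r where r: "0 \<le> r" "partial_integral x t = ennreal (t * r) + excess x r"
    by (rule partial_integral_excess_attained[OF x t])
  obtain r' where r': "0 \<le> r'" "partial_integral y t = ennreal (t * r') + excess y r'"
    by (rule partial_integral_excess_attained[OF y t])
  have "partial_integral (\<lambda>u. x u + y u) t \<le> ennreal (t * (r + r')) + excess (\<lambda>u. x u + y u) (r + r')"
    using r r' t by (intro partial_integral_le_excess z) auto
  also have "excess (\<lambda>u. x u + y u) (r + r') \<le> excess x r + excess y r'"
    unfolding excess_def
  proof (subst nn_integral_add[symmetric]; (measurable)?; intro nn_integral_mono)
    fix u
    show "ennreal (\<bar>x u + y u\<bar> - (r + r')) \<le> ennreal (\<bar>x u\<bar> - r) + ennreal (\<bar>y u\<bar> - r')"
      by (rule order.trans[OF ennreal_leI[of _ "max 0 (\<bar>x u\<bar> - r) + max 0 (\<bar>y u\<bar> - r')"]])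
         (auto simp: max_def ennreal_neg simp flip: ennreal_plus)
  qed
  finally show ?thesis using r r' t
    by (simp add: distrib_left ennreal_plus ac_simps add_left_mono)
qed (simp add: partial_integral_nonpos)

text \<open>
  Converse to subadditivity at the price of a longer interval. For nonnegative functions and a common
  level \<open>r\<close>, \<open>(x - r)\<^sup>+ + (y - r)\<^sup>+ \<le> (x + y - r)\<^sup>+\<close>, and \<open>s r + t r = (s + t) r\<close>.
\<close>

lemma partial_integral_add_ge:
  assumes x: "x \<in> L1_plus_Linf" "AE u in semiaxis. 0 \<le> x u"
    and y: "y \<in> L1_plus_Linf" "AE u in semiaxis. 0 \<le> y u"
    and z: "(\<lambda>u. x u + y u) \<in> L1_plus_Linf" and st: "0 \<le> s" "0 \<le> t"
  shows "partial_integral x s + partial_integral y t \<le> partial_integral (\<lambda>u. x u + y u) (s + t)"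
proof (cases "0 < s + t")
  case True
  note [measurable] = L1_plus_Linf_measurable[OF x(1)] L1_plus_Linf_measurable[OF y(1)]
  obtain r where r: "0 \<le> r"
    "partial_integral (\<lambda>u. x u + y u) (s + t) = ennreal ((s + t) * r) + excess (\<lambda>u. x u + y u) r"
    by (rule partial_integral_excess_attained[OF z True])
  have "partial_integral x s + partial_integral y t
      \<le> (ennreal (s * r) + excess x r) + (ennreal (t * r) + excess y r)"
    using st r by (intro add_mono partial_integral_le_excess x y)
  also have "\<dots> = ennreal ((s + t) * r) + (excess x r + excess y r)"
  proof -
    have "ennreal ((s + t) * r) = ennreal (s * r) + ennreal (t * r)"
      using st r by (simp add: distrib_right)
    then show ?thesis by (simp only: ac_simps)
  qed
  also have "excess x r + excess y r \<le> excess (\<lambda>u. x u + y u) r"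
    unfolding excess_def
  proof (subst nn_integral_add[symmetric]; (measurable)?; intro nn_integral_mono_AE)
    show "AE u in semiaxis. ennreal (\<bar>x u\<bar> - r) + ennreal (\<bar>y u\<bar> - r) \<le> ennreal (\<bar>x u + y u\<bar> - r)"
      using x(2) y(2)
    proof eventually_elim
      case (elim u)
      then show ?case using r(1)
        by (cases "r \<le> x u"; cases "r \<le> y u")
           (auto simp: ennreal_neg ennreal_leI simp flip: ennreal_plus)
    qed
  qed
  finally show ?thesis using r by (simp add: add_left_mono)
qed (use st in \<open>simp add: partial_integral_nonpos\<close>)

lemma excess_scale:
  assumes x: "x \<in> borel_measurable semiaxis" and c: "0 < c"
  shows "excess (\<lambda>u. c * x u) (c * r) = ennreal c * excess x r"
proof -
  note [measurable] = x
  have "excess (\<lambda>u. c * x u) (c * r) = (\<integral>\<^sup>+u. ennreal c * ennreal (\<bar>x u\<bar> - r) \<partial>semiaxis)"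
    unfolding excess_def using c
    by (intro nn_integral_cong) (simp add: abs_mult right_diff_distrib flip: ennreal_mult')
  also have "\<dots> = ennreal c * excess x r"
    unfolding excess_def by (rule nn_integral_cmult) measurable
  finally show ?thesis .
qed

lemma partial_integral_scale_le:
  assumes x: "x \<in> L1_plus_Linf" and cx: "(\<lambda>u. c * x u) \<in> L1_plus_Linf" and c: "0 < c"
  shows "partial_integral (\<lambda>u. c * x u) t \<le> ennreal c * partial_integral x t"
proof (cases "0 < t")
  case t: True
  obtain r where r: "0 \<le> r" "partial_integral x t = ennreal (t * r) + excess x r"
    by (rule partial_integral_excess_attained[OF x t])
  have "partial_integral (\<lambda>u. c * x u) t \<le> ennreal (t * (c * r)) + excess (\<lambda>u. c * x u) (c * r)"
    using r t c by (intro partial_integral_le_excess cx) auto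
  also have "\<dots> = ennreal c * partial_integral x t"
    using t c r unfolding r excess_scale[OF L1_plus_Linf_measurable[OF x] c]
    by (simp add: distrib_left ennreal_mult ac_simps)
  finally show ?thesis .
qed (simp add: partial_integral_nonpos)

lemma partial_integral_scale:
  assumes x: "x \<in> L1_plus_Linf" and cx: "(\<lambda>u. c * x u) \<in> L1_plus_Linf" and c: "0 < c"
  shows "partial_integral (\<lambda>u. c * x u) t = ennreal c * partial_integral x t"
proof (rule antisym[OF partial_integral_scale_le[OF assms]])
  have "partial_integral (\<lambda>u. (1/c) * (c * x u)) t \<le> ennreal (1/c) * partial_integral (\<lambda>u. c * x u) t"
    using c x by (intro partial_integral_scale_le[OF cx]) auto
  then have "partial_integral x t \<le> ennreal (1/c) * partial_integral (\<lambda>u. c * x u) t" using c by simp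
  then have "ennreal c * partial_integral x t \<le> ennreal c * (ennreal (1/c) * partial_integral (\<lambda>u. c * x u) t)"
    by (rule mult_left_mono) simp
  also have "\<dots> = partial_integral (\<lambda>u. c * x u) t"
    using c by (simp add: mult.assoc[symmetric] flip: ennreal_mult)
  finally show "ennreal c * partial_integral x t \<le> partial_integral (\<lambda>u. c * x u) t" .
qed

lemma partial_integral_null:
  assumes "x \<in> L1_plus_Linf" "AE u in semiaxis. x u = 0"
  shows "partial_integral x t = 0"
proof (cases "0 < t")
  case True
  have "excess x 0 = (\<integral>\<^sup>+u. 0 \<partial>semiaxis)"
    unfolding excess_def by (rule nn_integral_cong_AE) (use assms(2) in eventually_elim, simp)
  then show ?thesis using partial_integral_le_excess[OF assms(1), of 0 t] True by simp
qed (simp add: partial_integral_nonpos)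

lemma partial_integral_abs: "partial_integral (\<lambda>u. \<bar>x u\<bar>) t = partial_integral x t"
  unfolding partial_integral_def rearrangement_def by simp

text \<open>
  For a nonincreasing function both sides satisfy the same variational formula, so that there is no
  need to compute its rearrangement.
\<close>

lemma partial_integral_antimono:
  assumes gL: "g \<in> L1_plus_Linf"
    and g: "\<And>s. 0 < s \<Longrightarrow> 0 \<le> g s" "\<And>s t. 0 < s \<Longrightarrow> s \<le> t \<Longrightarrow> g t \<le> g s"
  shows "partial_integral g t = (\<integral>\<^sup>+s\<in>{0<..<t}. ennreal (g s) \<partial>lborel)"
proof (cases "0 < t")
  case t: True
  show ?thesis
  proof (rule antisym)
    have "partial_integral g t \<le> ennreal (t * g t) + excess g (g t)"
      using t g(1)[OF t] by (intro partial_integral_le_excess gL) auto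
    also have "\<dots> = (\<integral>\<^sup>+s\<in>{0<..<t}. ennreal (g s) \<partial>lborel)"
      by (rule integral_le_excess(2)[symmetric]) (use t g in auto)
    finally show "partial_integral g t \<le> (\<integral>\<^sup>+s\<in>{0<..<t}. ennreal (g s) \<partial>lborel)" .
    obtain r where r: "0 \<le> r" "partial_integral g t = ennreal (t * r) + excess g r"
      by (rule partial_integral_excess_attained[OF gL t])
    show "(\<integral>\<^sup>+s\<in>{0<..<t}. ennreal (g s) \<partial>lborel) \<le> partial_integral g t"
      unfolding r(2) by (rule integral_le_excess(1)) (use t g r in auto)
  qed
qed (simp add: partial_integral_nonpos)

lemma antimono_in_L1_plus_Linf:
  assumes g: "\<And>s. 0 < s \<Longrightarrow> 0 \<le> g s" "\<And>s t. 0 < s \<Longrightarrow> s \<le> t \<Longrightarrow> g t \<le> g s"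
    and fin: "(\<integral>\<^sup>+s\<in>{0<..<1}. ennreal (g s) \<partial>lborel) < \<infinity>"
  shows "g \<in> L1_plus_Linf"
proof -
  note [measurable] = antimono_measurable(2)[of g, OF g(2)]
  have [measurable]: "{0<..<1::real} \<in> sets semiaxis" "{1::real..} \<in> sets semiaxis"
    by (auto simp: sets_restrict_space_iff)
  have "integrable semiaxis (\<lambda>s. indicator {0<..<1} s * g s)"
  proof (rule integrableI_bounded)
    have "(\<integral>\<^sup>+s. ennreal (norm (indicator {0<..<1} s * g s)) \<partial>semiaxis)
        = (\<integral>\<^sup>+s\<in>{0<..<1}. ennreal (g s) \<partial>lborel)"
      unfolding nn_integral_semiaxis
      by (intro nn_integral_cong) (use g(1) in \<open>auto split: split_indicator\<close>)
    then show "(\<integral>\<^sup>+s. ennreal (norm (indicator {0<..<1} s * g s)) \<partial>semiaxis) < \<infinity>" using fin by simp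
  qed measurable
  moreover have "(\<lambda>s. indicator {1..} s * g s) \<in> borel_measurable semiaxis" by measurable
  moreover have "AE s in semiaxis. \<bar>indicator {1..} s * g s\<bar> \<le> g 1"
    using g(1)[of 1] g(1) g(2)[of 1] by (auto intro!: AE_I2 split: split_indicator)
  moreover have "\<forall>u>0. g u = indicator {0<..<1} u * g u + indicator {1..} u * g u"
    by (auto split: split_indicator)
  ultimately show ?thesis unfolding L1_plus_Linf_def by blast
qed

section \<open>Contractions\<close>

text \<open>
  The function \<open>(1/m) \<sigma>\<^sub>m \<mu>(x)\<close>, whose norm is to be studied as \<open>m\<close> grows. It is named after its effect
  on partial integrals, whose argument is divided by \<open>m\<close>.
\<close>

definition contraction :: "nat \<Rightarrow> (real \<Rightarrow> real) \<Rightarrow> real \<Rightarrow> real" where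
  "contraction m x t = (1 / real m) * dilation (real m) (rearrangement x) t"

lemma contraction_props:
  assumes x: "x \<in> L1_plus_Linf" and m: "0 < m"
  shows "contraction m x \<in> L1_plus_Linf"
    and "partial_integral (contraction m x) t = partial_integral x (t / real m)"
proof -
  have nn: "0 \<le> contraction m x s" if "0 < s" for s
    using rearrangement_nonneg[OF x, of "s / m"] that m by (simp add: contraction_def dilation_def)
  have anti: "contraction m x t \<le> contraction m x s" if "0 < s" "s \<le> t" for s t
    using rearrangement_antimono[OF x, of "s / m" "t / m"] that m
    by (simp add: contraction_def dilation_def divide_right_mono)
  have int: "(\<integral>\<^sup>+s\<in>{0<..<t}. ennreal (contraction m x s) \<partial>lborel) = partial_integral x (t / real m)" for t
  proof -
    have [measurable]: "(\<lambda>s. ennreal (contraction m x s) * indicator {0<..<t} s) \<in> borel_measurable borel"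
    proof -
      have "(\<lambda>s. ennreal (contraction m x s)) \<in> borel_measurable (restrict_space borel {0<..})"
        using antimono_measurable(1)[of "contraction m x", OF anti] by measurable
      then have "(\<lambda>s. ennreal (contraction m x s) * indicator {0<..} s) \<in> borel_measurable borel"
        by (subst (asm) borel_measurable_restrict_space_iff_ennreal) auto
      then have "(\<lambda>s. (ennreal (contraction m x s) * indicator {0<..} s) * indicator {..<t} s) \<in> borel_measurable borel"
        by measurable
      then show ?thesis by (rule measurable_cong[THEN iffD1, rotated]) (auto split: split_indicator)
    qed
    have "(\<integral>\<^sup>+s\<in>{0<..<t}. ennreal (contraction m x s) \<partial>lborel)
        = ennreal \<bar>real m\<bar> * (\<integral>\<^sup>+s. ennreal (contraction m x (0 + real m * s)) * indicator {0<..<t} (0 + real m * s) \<partial>lborel)"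
      using m by (intro nn_integral_real_affine) auto
    also have "\<dots> = (\<integral>\<^sup>+s. ennreal \<bar>real m\<bar> * (ennreal (contraction m x (0 + real m * s)) * indicator {0<..<t} (0 + real m * s)) \<partial>lborel)"
      by (rule nn_integral_cmult[symmetric]) measurable
    also have "\<dots> = partial_integral x (t / real m)"
      unfolding partial_integral_def
    proof (rule nn_integral_cong)
      fix s
      have "ennreal (real m) * ennreal (contraction m x (real m * s)) = ennreal (rearrangement x s)"
        using m by (simp add: contraction_def dilation_def flip: ennreal_mult')
      moreover have "real m * s \<in> {0<..<t} \<longleftrightarrow> s \<in> {0<..<t / real m}"
        using m by (auto simp: field_simps zero_less_mult_iff)
      ultimately show "ennreal \<bar>real m\<bar> * (ennreal (contraction m x (0 + real m * s)) * indicator {0<..<t} (0 + real m * s))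
         = ennreal (rearrangement x s) * indicator {0<..<t / real m} s"
        by (simp add: indicator_def)
    qed
    finally show ?thesis .
  qed
  show L: "contraction m x \<in> L1_plus_Linf"
    using partial_integral_finite[OF x] by (intro antimono_in_L1_plus_Linf nn anti) (simp_all add: int)
  show "partial_integral (contraction m x) t = partial_integral x (t / real m)"
    using partial_integral_antimono[OF L nn anti, of t] by (simp add: int)
qed

section \<open>Domination and the sublinear functional\<close>

lemma submajorized_iff_partial_integral:
  "y \<prec>\<prec> x \<longleftrightarrow> (\<forall>t\<ge>0. partial_integral y t \<le> partial_integral x t)"
  unfolding submajorized_def partial_integral_def ..

text \<open>
  In \<open>\<bar>f + g\<bar> = (\<bar>f + g\<bar> - \<bar>g\<bar>) + \<bar>g\<bar>\<close> the first summand is bounded by \<open>\<bar>f\<bar>\<close>.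
\<close>

lemma abs_in_L1_plus_Linf:
  assumes "x \<in> L1_plus_Linf"
  shows "(\<lambda>u. \<bar>x u\<bar>) \<in> L1_plus_Linf"
proof -
  from assms obtain f g C where fg: "integrable semiaxis f" "g \<in> borel_measurable semiaxis"
    "AE u in semiaxis. \<bar>g u\<bar> \<le> C" "\<forall>u>0. x u = f u + g u" unfolding L1_plus_Linf_def by auto
  note [measurable] = fg(2) borel_measurable_integrable[OF fg(1)]
  have "integrable semiaxis (\<lambda>u. \<bar>f u + g u\<bar> - \<bar>g u\<bar>)"
    by (rule Bochner_Integration.integrable_bound[OF fg(1)]) auto
  moreover have "(\<lambda>u. \<bar>g u\<bar>) \<in> borel_measurable semiaxis" by measurable
  moreover have "\<exists>C. AE u in semiaxis. \<bar>\<bar>g u\<bar>\<bar> \<le> C" using fg(3) by auto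
  moreover have "\<forall>u>0. \<bar>x u\<bar> = (\<bar>f u + g u\<bar> - \<bar>g u\<bar>) + \<bar>g u\<bar>" using fg(4) by simp
  ultimately show ?thesis unfolding L1_plus_Linf_def by blast
qed

locale fully_symmetric =
  fixes E :: "(real \<Rightarrow> real) set" and N :: "(real \<Rightarrow> real) \<Rightarrow> real"
  assumes fully_symmetric: "fully_symmetric_space E N"
begin

lemma E_L: "x \<in> E \<Longrightarrow> x \<in> L1_plus_Linf"
  and zero_E: "(\<lambda>u. 0) \<in> E"
  and add_E: "x \<in> E \<Longrightarrow> y \<in> E \<Longrightarrow> (\<lambda>u. x u + y u) \<in> E"
  and scale_E: "x \<in> E \<Longrightarrow> (\<lambda>u. c * x u) \<in> E"
  and N_nonneg: "x \<in> E \<Longrightarrow> 0 \<le> N x"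
  and N_scale: "x \<in> E \<Longrightarrow> N (\<lambda>u. c * x u) = \<bar>c\<bar> * N x"
  and N_add: "x \<in> E \<Longrightarrow> y \<in> E \<Longrightarrow> N (\<lambda>u. x u + y u) \<le> N x + N y"
  using fully_symmetric unfolding fully_symmetric_space_def banach_function_space_def by blast+

lemma N_zero: "N (\<lambda>u. 0) = 0"
  using N_scale[OF zero_E, of 0] by simp

lemma submajorized_E:
  assumes "x \<in> E" "y \<in> L1_plus_Linf" "\<And>t. 0 \<le> t \<Longrightarrow> partial_integral y t \<le> partial_integral x t"
  shows "y \<in> E" "N y \<le> N x"
  using assms fully_symmetric unfolding fully_symmetric_space_def submajorized_iff_partial_integral by blast+

lemma function_space_E: "function_space E"
  unfolding function_space_def using zero_E add_E scale_E by blast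

lemma abs_E: "x \<in> E \<Longrightarrow> (\<lambda>u. \<bar>x u\<bar>) \<in> E"
  by (rule submajorized_E(1)[of x]) (auto simp: partial_integral_abs intro: abs_in_L1_plus_Linf E_L)

lemma contraction_E:
  assumes x: "x \<in> E" and m: "0 < m"
  shows "contraction m x \<in> E"
  using contraction_props[OF E_L[OF x] m] m
  by (intro submajorized_E(1)[OF x]) (auto intro!: partial_integral_mono simp: divide_le_eq mult_le_cancel_left1)

text \<open>
  A form of \<open>z + v \<prec>\<prec> v + a\<close> for some \<open>v \<ge> 0\<close> that is weakened by an arbitrary rescaling \<open>L\<close> of
  the argument. The element \<open>v\<close> lets differences \<open>z = y - x\<close> with \<open>y \<prec>\<prec> x\<close> be dominated by zero. The
  factor \<open>L\<close> absorbs the loss in passing between \<open>partial_integral v + partial_integral v'\<close> and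
  \<open>partial_integral (v + v')\<close>, which is what makes the relation compatible with addition; fully symmetric
  functionals do not feel it, since they agree on \<open>x \<ge> 0\<close> and on all contractions of \<open>x\<close>.
\<close>

definition dominated :: "(real \<Rightarrow> real) \<Rightarrow> (real \<Rightarrow> real) \<Rightarrow> bool" where
  "dominated z a \<longleftrightarrow> (AE u in semiaxis. 0 \<le> a u) \<and>
     (\<exists>v\<in>E. (AE u in semiaxis. 0 \<le> v u) \<and> (AE u in semiaxis. 0 \<le> z u + v u) \<and>
        (\<exists>L\<ge>1::nat. \<forall>t\<ge>0. partial_integral (\<lambda>u. z u + v u) t
           \<le> partial_integral v (real L * t) + partial_integral a (real L * t)))"

lemma dominatedI:
  assumes "AE u in semiaxis. 0 \<le> a u" "v \<in> E" "AE u in semiaxis. 0 \<le> v u"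
    "AE u in semiaxis. 0 \<le> z u + v u" "1 \<le> L"
    "\<And>t. 0 \<le> t \<Longrightarrow> partial_integral (\<lambda>u. z u + v u) t
           \<le> partial_integral v (real L * t) + partial_integral a (real L * t)"
  shows "dominated z a"
  using assms unfolding dominated_def by blast

lemma dominatedE:
  assumes "dominated z a"
  obtains v L where "AE u in semiaxis. 0 \<le> a u" "v \<in> E" "AE u in semiaxis. 0 \<le> v u"
    "AE u in semiaxis. 0 \<le> z u + v u" "1 \<le> L"
    "\<And>t. 0 \<le> t \<Longrightarrow> partial_integral (\<lambda>u. z u + v u) t
           \<le> partial_integral v (real L * t) + partial_integral a (real L * t)"
  using assms unfolding dominated_def by blast

text \<open>
  The two scales \<open>L\<close> and \<open>L'\<close> are replaced by a common one, which is then doubled to combine the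
  partial integrals on the right.
\<close>

lemma dominated_add:
  assumes E: "z \<in> E" "z' \<in> E" "a \<in> E" "a' \<in> E"
    and d: "dominated z a" "dominated z' a'"
  shows "dominated (\<lambda>u. z u + z' u) (\<lambda>u. a u + a' u)"
proof -
  obtain v L where v: "AE u in semiaxis. 0 \<le> a u" "v \<in> E" "AE u in semiaxis. 0 \<le> v u"
    "AE u in semiaxis. 0 \<le> z u + v u" "1 \<le> L"
    "\<And>t. 0 \<le> t \<Longrightarrow> partial_integral (\<lambda>u. z u + v u) t
           \<le> partial_integral v (real L * t) + partial_integral a (real L * t)"
    using dominatedE[OF d(1)] by blast
  obtain v' L' where v': "AE u in semiaxis. 0 \<le> a' u" "v' \<in> E" "AE u in semiaxis. 0 \<le> v' u"
    "AE u in semiaxis. 0 \<le> z' u + v' u" "1 \<le> L'"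
    "\<And>t. 0 \<le> t \<Longrightarrow> partial_integral (\<lambda>u. z' u + v' u) t
           \<le> partial_integral v' (real L' * t) + partial_integral a' (real L' * t)"
    using dominatedE[OF d(2)] by blast
  define M where "M = L + L'"
  have M: "L \<le> M" "L' \<le> M" unfolding M_def by auto
  show ?thesis
  proof (rule dominatedI)
    show "AE u in semiaxis. 0 \<le> a u + a' u" using v(1) v'(1) by eventually_elim auto
    show "(\<lambda>u. v u + v' u) \<in> E" by (intro add_E v v')
    show "AE u in semiaxis. 0 \<le> v u + v' u" using v(3) v'(3) by eventually_elim auto
    show "AE u in semiaxis. 0 \<le> z u + z' u + (v u + v' u)"
      using v(4) v'(4) by eventually_elim auto
    show "1 \<le> 2 * M" using v(5) M by simp
    fix t :: real assume t: "0 \<le> t"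
    have up: "partial_integral y (real K * t) \<le> partial_integral y (real M * t)" if "K \<le> M" for y K
      using that t by (intro partial_integral_mono mult_right_mono) auto
    have double: "partial_integral y (real M * t) + partial_integral y' (real M * t)
        \<le> partial_integral (\<lambda>u. y u + y' u) (real (2 * M) * t)"
      if "y \<in> E" "y' \<in> E" "AE u in semiaxis. 0 \<le> y u" "AE u in semiaxis. 0 \<le> y' u" for y y'
      using partial_integral_add_ge[of y y' "real M * t" "real M * t"] that t E_L add_E
      by (simp add: algebra_simps)
    have "partial_integral (\<lambda>u. z u + z' u + (v u + v' u)) t
        = partial_integral (\<lambda>u. (z u + v u) + (z' u + v' u)) t"
      by (simp add: ac_simps)
    also have "\<dots> \<le> partial_integral (\<lambda>u. z u + v u) t + partial_integral (\<lambda>u. z' u + v' u) t"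
      by (intro partial_integral_add_le E_L add_E E v v')
    also have "\<dots> \<le> (partial_integral v (real L * t) + partial_integral a (real L * t))
        + (partial_integral v' (real L' * t) + partial_integral a' (real L' * t))"
      using t by (intro add_mono v v')
    also have "\<dots> \<le> (partial_integral v (real M * t) + partial_integral a (real M * t))
        + (partial_integral v' (real M * t) + partial_integral a' (real M * t))"
      by (intro add_mono up M)
    also have "\<dots> = (partial_integral v (real M * t) + partial_integral v' (real M * t))
        + (partial_integral a (real M * t) + partial_integral a' (real M * t))"
      by (simp only: ac_simps)
    also have "\<dots> \<le> partial_integral (\<lambda>u. v u + v' u) (real (2 * M) * t)
        + partial_integral (\<lambda>u. a u + a' u) (real (2 * M) * t)"
      by (intro add_mono double E v v')
    finally show "partial_integral (\<lambda>u. z u + z' u + (v u + v' u)) t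
      \<le> partial_integral (\<lambda>u. v u + v' u) (real (2 * M) * t)
        + partial_integral (\<lambda>u. a u + a' u) (real (2 * M) * t)" .
  qed
qed

lemma dominated_scale:
  assumes E: "z \<in> E" "a \<in> E" and d: "dominated z a" and c: "0 < c"
  shows "dominated (\<lambda>u. c * z u) (\<lambda>u. c * a u)"
proof -
  obtain v L where v: "AE u in semiaxis. 0 \<le> a u" "v \<in> E" "AE u in semiaxis. 0 \<le> v u"
    "AE u in semiaxis. 0 \<le> z u + v u" "1 \<le> L"
    "\<And>t. 0 \<le> t \<Longrightarrow> partial_integral (\<lambda>u. z u + v u) t
           \<le> partial_integral v (real L * t) + partial_integral a (real L * t)"
    using dominatedE[OF d] by blast
  have scale: "partial_integral (\<lambda>u. c * y u) t = ennreal c * partial_integral y t" if "y \<in> E" for y t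
    by (intro partial_integral_scale E_L that scale_E c)
  have eq: "(\<lambda>u. c * z u + c * v u) = (\<lambda>u. c * (z u + v u))" by (simp add: distrib_left)
  show ?thesis
  proof (rule dominatedI)
    show "AE u in semiaxis. 0 \<le> c * a u" using v(1) by eventually_elim (use c in simp)
    show "(\<lambda>u. c * v u) \<in> E" by (intro scale_E v)
    show "AE u in semiaxis. 0 \<le> c * v u" using v(3) by eventually_elim (use c in simp)
    show "AE u in semiaxis. 0 \<le> c * z u + c * v u"
      using v(4) by eventually_elim (use c in \<open>simp flip: distrib_left\<close>)
    show "1 \<le> L" by fact
    fix t :: real assume t: "0 \<le> t"
    show "partial_integral (\<lambda>u. c * z u + c * v u) t
      \<le> partial_integral (\<lambda>u. c * v u) (real L * t) + partial_integral (\<lambda>u. c * a u) (real L * t)"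
      unfolding eq using v(6)[OF t] E v(2)
      by (simp add: scale add_E mult_left_mono flip: distrib_left)
  qed
qed

definition majorant_norm :: "(real \<Rightarrow> real) \<Rightarrow> real" where
  "majorant_norm z = Inf (N ` {a\<in>E. dominated z a})"

lemma bdd_below_majorant_norm: "bdd_below (N ` {a\<in>E. dominated z a})"
  by (rule bdd_belowI2[of _ 0]) (auto intro: N_nonneg)

lemma majorant_norm_le: "a \<in> E \<Longrightarrow> dominated z a \<Longrightarrow> majorant_norm z \<le> N a"
  unfolding majorant_norm_def by (rule cInf_lower[OF _ bdd_below_majorant_norm]) auto

lemma ex_dominated:
  assumes z: "z \<in> E"
  shows "\<exists>a\<in>E. dominated z a"
proof -
  have "dominated z (\<lambda>u. \<bar>z u\<bar>)"
  proof (rule dominatedI)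
    show "(\<lambda>u. \<bar>z u\<bar>) \<in> E" by (rule abs_E[OF z])
    fix t :: real assume "0 \<le> t"
    have "partial_integral (\<lambda>u. z u + \<bar>z u\<bar>) t \<le> partial_integral z t + partial_integral (\<lambda>u. \<bar>z u\<bar>) t"
      by (intro partial_integral_add_le E_L add_E abs_E z)
    then show "partial_integral (\<lambda>u. z u + \<bar>z u\<bar>) t
      \<le> partial_integral (\<lambda>u. \<bar>z u\<bar>) (real 1 * t) + partial_integral (\<lambda>u. \<bar>z u\<bar>) (real 1 * t)"
      by (simp add: partial_integral_abs)
  qed auto
  then show ?thesis using abs_E[OF z] by blast
qed

lemma majorant_norm_greatest:
  assumes "z \<in> E" "\<And>a. a \<in> E \<Longrightarrow> dominated z a \<Longrightarrow> b \<le> N a"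
  shows "b \<le> majorant_norm z"
  unfolding majorant_norm_def using ex_dominated[OF assms(1)] assms(2) by (intro cInf_greatest) auto

lemma majorant_norm_nonpos:
  assumes "dominated z (\<lambda>u. 0)"
  shows "majorant_norm z \<le> 0"
  using majorant_norm_le[OF zero_E assms] N_zero by simp

lemma dominated_null:
  assumes z: "z \<in> E" "AE u in semiaxis. z u = 0"
  shows "dominated z (\<lambda>u. 0)"
proof (rule dominatedI[where v="\<lambda>u. 0" and L=1])
  show "AE u in semiaxis. 0 \<le> z u + 0" using z(2) by eventually_elim simp
qed (use zero_E partial_integral_null[OF E_L[OF z(1)] z(2)] in auto)

lemma dominated_diff:
  assumes "x \<in> E" "AE u in semiaxis. 0 \<le> x u" "AE u in semiaxis. 0 \<le> y u" "y \<prec>\<prec> x"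
  shows "dominated (\<lambda>u. y u + - 1 * x u) (\<lambda>u. 0)"
proof (rule dominatedI[where L=1 and v=x])
  fix t :: real assume "0 \<le> t"
  then have "partial_integral y t \<le> partial_integral x t"
    using assms(4) unfolding submajorized_iff_partial_integral by blast
  then show "partial_integral (\<lambda>u. y u + - 1 * x u + x u) t
      \<le> partial_integral x (real 1 * t) + partial_integral (\<lambda>u. 0) (real 1 * t)"
    by (simp add: add_increasing2)
qed (use assms in auto)

lemma sublinear_majorant_norm: "sublinear_on E majorant_norm"
  unfolding sublinear_on_def
proof (intro conjI ballI allI impI)
  fix x y assume xy: "x \<in> E" "y \<in> E"
  have "majorant_norm (\<lambda>u. x u + y u) - N b \<le> N a"
    if "a \<in> E" "dominated x a" "b \<in> E" "dominated y b" for a b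
  proof -
    have "majorant_norm (\<lambda>u. x u + y u) \<le> N (\<lambda>u. a u + b u)"
      by (intro majorant_norm_le add_E dominated_add that xy)
    also have "\<dots> \<le> N a + N b" by (rule N_add[OF that(1,3)])
    finally show ?thesis by simp
  qed
  then have "majorant_norm (\<lambda>u. x u + y u) - N b \<le> majorant_norm x" if "b \<in> E" "dominated y b" for b
    using that by (intro majorant_norm_greatest xy)
  then have "majorant_norm (\<lambda>u. x u + y u) - majorant_norm x \<le> majorant_norm y"
    by (intro majorant_norm_greatest xy) (simp add: algebra_simps)
  then show "majorant_norm (\<lambda>u. x u + y u) \<le> majorant_norm x + majorant_norm y" by simp
next
  fix c :: real and x assume c: "0 \<le> c" and x: "x \<in> E"
  show "majorant_norm (\<lambda>u. c * x u) \<le> c * majorant_norm x"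
  proof (cases "c = 0")
    case True
    then show ?thesis using majorant_norm_nonpos[OF dominated_null[OF zero_E]] by simp
  next
    case False
    then have c: "0 < c" using c by simp
    have "majorant_norm (\<lambda>u. c * x u) / c \<le> majorant_norm x"
    proof (rule majorant_norm_greatest[OF x])
      fix a assume a: "a \<in> E" "dominated x a"
      have "majorant_norm (\<lambda>u. c * x u) \<le> N (\<lambda>u. c * a u)"
        by (intro majorant_norm_le scale_E dominated_scale a x c)
      then show "majorant_norm (\<lambda>u. c * x u) / c \<le> N a" using c by (simp add: N_scale[OF a(1)] field_simps)
    qed
    then show ?thesis using c by (simp add: field_simps)
  qed
qed

text \<open>
  Iteration of the hypothesis along the points \<open>t / M\<^sup>j\<close>: the terms in \<open>v\<close> telescope, so only one
  copy of \<open>v\<close> remains against \<open>k\<close> copies of \<open>a\<close>. All terms in \<open>x\<close> are bounded below by the one at the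
  smallest argument.
\<close>

lemma telescope:
  assumes step: "\<And>t. 0 \<le> t \<Longrightarrow> partial_integral x t + partial_integral v t
      \<le> partial_integral v (real M * t) + partial_integral a (real M * t)"
    and M: "1 \<le> M" and t: "0 \<le> t"
  shows "of_nat k * partial_integral x (t / real M ^ k) + partial_integral v (t / real M ^ k)
      \<le> partial_integral v t + of_nat k * partial_integral a t"
proof (induction k)
  case (Suc k)
  define s where "s = t / real M ^ k"
  have s: "t / real M ^ Suc k = s / real M" "0 \<le> s" "s \<le> t"
    using M t by (auto simp: s_def divide_le_eq mult_le_cancel_left1)
  have sM: "s / real M \<le> s" using s M by (simp add: divide_le_eq mult_le_cancel_left1)
  have "partial_integral x (s / real M) + partial_integral v (s / real M)
      \<le> partial_integral v s + partial_integral a s"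
    using step[of "s / real M"] s M by simp
  also have "\<dots> \<le> partial_integral v s + partial_integral a t"
    by (intro add_left_mono partial_integral_mono s)
  finally have 1: "partial_integral x (s / real M) + partial_integral v (s / real M)
      \<le> partial_integral v s + partial_integral a t" .
  have "of_nat (Suc k) * partial_integral x (s / real M) + partial_integral v (s / real M)
      = of_nat k * partial_integral x (s / real M)
        + (partial_integral x (s / real M) + partial_integral v (s / real M))"
    by (simp add: distrib_right ac_simps)
  also have "\<dots> \<le> of_nat k * partial_integral x s + (partial_integral v s + partial_integral a t)"
    by (intro add_mono[OF mult_left_mono 1] partial_integral_mono sM) simp
  also have "\<dots> = (of_nat k * partial_integral x s + partial_integral v s) + partial_integral a t"
    by (simp only: ac_simps)
  also have "\<dots> \<le> (partial_integral v t + of_nat k * partial_integral a t) + partial_integral a t"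
    using Suc.IH unfolding s_def by (rule add_right_mono)
  also have "\<dots> = partial_integral v t + of_nat (Suc k) * partial_integral a t"
    by (simp add: distrib_right add.assoc add.commute add.left_commute)
  finally show ?case unfolding s(1) .
qed simp

text \<open>
  By telescoping, \<open>k\<close> times a far contraction of \<open>x\<close> is submajorized by \<open>v + k a\<close>. After taking norms
  and dividing by \<open>k\<close> the contribution of \<open>v\<close> is negligible.
\<close>

lemma contraction_norm_bound:
  assumes x: "x \<in> E" "AE u in semiaxis. 0 \<le> x u" and a: "a \<in> E" "dominated x a"
    and c: "\<And>m. 0 < m \<Longrightarrow> c \<le> N (contraction m x)"
  shows "c \<le> N a"
proof -
  obtain v L where v: "AE u in semiaxis. 0 \<le> a u" "v \<in> E" "AE u in semiaxis. 0 \<le> v u"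
    "1 \<le> L"
    "\<And>t. 0 \<le> t \<Longrightarrow> partial_integral (\<lambda>u. x u + v u) t
           \<le> partial_integral v (real L * t) + partial_integral a (real L * t)"
    using dominatedE[OF a(2)] by blast
  define M where "M = 2 * L"
  have M: "1 \<le> M" using v(4) by (simp add: M_def)
  have step: "partial_integral x t + partial_integral v t
      \<le> partial_integral v (real M * t) + partial_integral a (real M * t)" if t: "0 \<le> t" for t
  proof -
    have "partial_integral x t + partial_integral v t \<le> partial_integral (\<lambda>u. x u + v u) (t + t)"
      by (intro partial_integral_add_ge E_L add_E x v t)
    also have "\<dots> \<le> partial_integral v (real M * t) + partial_integral a (real M * t)"
      using v(5)[of "t + t"] t by (simp add: M_def algebra_simps)
    finally show ?thesis .
  qed
  have bound: "c \<le> N a + N v / real k" if k: "0 < k" for k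
  proof -
    (* M ^ k comes from k telescoping steps, the factor 2 from merging v and k a into one function. *)
    define m where "m = 2 * M ^ k"
    have m: "0 < m" using M by (simp add: m_def)
    have "partial_integral (\<lambda>u. real k * contraction m x u) t
        \<le> partial_integral (\<lambda>u. v u + real k * a u) t" if t: "0 \<le> t" for t
    proof -
      have "partial_integral (\<lambda>u. real k * contraction m x u) t
          = ennreal (real k) * partial_integral (contraction m x) t"
        using k by (intro partial_integral_scale E_L scale_E contraction_E x m) auto
      also have "\<dots> = of_nat k * partial_integral x ((t / 2) / real M ^ k)"
        unfolding contraction_props(2)[OF E_L[OF x(1)] m]
        by (simp add: m_def ennreal_of_nat_eq_real_of_nat)
      also have "\<dots> \<le> \<dots> + partial_integral v ((t / 2) / real M ^ k)" by simp
      also have "\<dots> \<le> partial_integral v (t / 2) + of_nat k * partial_integral a (t / 2)"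
        using t by (intro telescope step M) auto
      also have "\<dots> = partial_integral v (t / 2) + partial_integral (\<lambda>u. real k * a u) (t / 2)"
        using k partial_integral_scale[OF E_L[OF a(1)] E_L[OF scale_E[OF a(1)]], of "real k"]
        by (simp add: ennreal_of_nat_eq_real_of_nat)
      also have "\<dots> \<le> partial_integral (\<lambda>u. v u + real k * a u) (t / 2 + t / 2)"
      proof (intro partial_integral_add_ge E_L add_E scale_E a v)
        show "AE u in semiaxis. 0 \<le> real k * a u" using v(1) by eventually_elim simp
      qed (use t in auto)
      finally show ?thesis by simp
    qed
    then have "N (\<lambda>u. real k * contraction m x u) \<le> N (\<lambda>u. v u + real k * a u)"
      by (intro submajorized_E(2)) (auto intro!: E_L add_E scale_E contraction_E x a v m)
    also have "\<dots> \<le> N v + real k * N a"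
      using N_add[OF v(2) scale_E[OF a(1)], of "real k"] by (simp add: N_scale a)
    finally have "real k * N (contraction m x) \<le> N v + real k * N a"
      by (simp add: N_scale contraction_E x m)
    then have "N (contraction m x) \<le> N a + N v / real k" using k by (simp add: field_simps)
    then show ?thesis using c[OF m] by linarith
  qed
  have "(\<lambda>k. N a + N v * inverse (real (Suc k))) \<longlonglongrightarrow> N a + N v * 0"
    by (intro tendsto_intros LIMSEQ_inverse_real_of_nat)
  moreover have "c \<le> N a + N v * inverse (real (Suc k))" for k
    using bound[of "Suc k"] by (simp add: divide_inverse)
  ultimately show ?thesis by (intro LIMSEQ_le_const) auto
qed

text \<open>
  The norms decrease because the contractions do with respect to submajorization. Each contraction
  dominates \<open>x\<close>, with scale \<open>L = m\<close> and \<open>v = 0\<close>, so the limit is at least the infimum over all dominating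
  elements; the preceding lemma is the reverse inequality.
\<close>

lemma contraction_norm_tendsto_majorant_norm:
  assumes x: "x \<in> E" "AE u in semiaxis. 0 \<le> x u"
  shows "(\<lambda>m. N (contraction m x)) \<longlonglongrightarrow> majorant_norm x"
proof -
  note props = contraction_props[OF E_L[OF x(1)]]
  have dec: "decseq (\<lambda>n. N (contraction (Suc n) x))"
  proof (rule decseq_SucI, rule submajorized_E(2))
    fix n t assume t: "0 \<le> (t::real)"
    have "t / real (Suc (Suc n)) \<le> t / real (Suc n)" using t by (intro divide_left_mono) auto
    then show "partial_integral (contraction (Suc (Suc n)) x) t \<le> partial_integral (contraction (Suc n) x) t"
      unfolding props(2)[OF zero_less_Suc] by (rule partial_integral_mono)
  qed (intro contraction_E E_L x zero_less_Suc)+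
  have nonneg: "\<forall>n. 0 \<le> N (contraction (Suc n) x)" by (intro allI N_nonneg contraction_E x) simp
  obtain c where c: "(\<lambda>n. N (contraction (Suc n) x)) \<longlonglongrightarrow> c"
    "\<forall>n. c \<le> N (contraction (Suc n) x)"
    by (rule decseq_convergent[OF dec nonneg])
  have "majorant_norm x = c"
  proof (rule antisym)
    have "majorant_norm x \<le> N (contraction (Suc n) x)" for n
    proof (rule majorant_norm_le[OF contraction_E[OF x(1)]])
      show "dominated x (contraction (Suc n) x)"
      proof (rule dominatedI[where v="\<lambda>u. 0" and L="Suc n"])
        show "AE u in semiaxis. 0 \<le> contraction (Suc n) x u"
          using rearrangement_nonneg[OF E_L[OF x(1)]]
          by (intro AE_I2) (auto simp: contraction_def dilation_def)
        fix t :: real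
        show "partial_integral (\<lambda>u. x u + 0) t \<le> partial_integral (\<lambda>u. 0) (real (Suc n) * t)
            + partial_integral (contraction (Suc n) x) (real (Suc n) * t)"
          unfolding props(2)[OF zero_less_Suc] by simp
      qed (use zero_E x in auto)
    qed simp
    then show "majorant_norm x \<le> c" by (intro LIMSEQ_le_const[OF c(1)]) auto
    have "c \<le> N (contraction m x)" if "0 < m" for m using c(2)[rule_format, of "m - 1"] that by simp
    note low = this
    show "c \<le> majorant_norm x" by (rule majorant_norm_greatest[OF x(1) contraction_norm_bound[OF x _ _ low]])
  qed
  with c(1) have "(\<lambda>n. N (contraction (Suc n) x)) \<longlonglongrightarrow> majorant_norm x" by (simp only:)
  then show ?thesis by (rule filterlim_sequentially_Suc[THEN iffD1])
qed

end

section \<open>Existence of the functional\<close>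

theorem theorem33:
  fixes E :: "(real \<Rightarrow> real) set" and N :: "(real \<Rightarrow> real) \<Rightarrow> real" and x :: "real \<Rightarrow> real"
  assumes "fully_symmetric_space E N"
    and "x \<in> E" and "AE u in semiaxis. 0 \<le> x u"
  shows "\<exists>\<phi>. fully_symmetric_functional E \<phi> \<and>
           (\<lambda>m::nat. 1 / real m * N (dilation (real m) (rearrangement x))) \<longlonglongrightarrow> \<phi> x"
proof -
  interpret fully_symmetric E N by unfold_locales (rule assms)
  obtain \<phi> where add: "\<And>x y. x \<in> E \<Longrightarrow> y \<in> E \<Longrightarrow> \<phi> (\<lambda>u. x u + y u) = \<phi> x + \<phi> y"
    and scale: "\<And>c x. x \<in> E \<Longrightarrow> \<phi> (\<lambda>u. c * x u) = c * \<phi> x"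
    and le: "\<And>x. x \<in> E \<Longrightarrow> \<phi> x \<le> majorant_norm x" and eq: "\<phi> x = majorant_norm x"
    by (rule hahn_banach_sublinear[OF function_space_E sublinear_majorant_norm assms(2)]) blast
  have diff_le: "\<phi> y \<le> \<phi> z" if "y \<in> E" "z \<in> E" "dominated (\<lambda>u. y u + - 1 * z u) (\<lambda>u. 0)" for y z
  proof -
    have "\<phi> (\<lambda>u. y u + - 1 * z u) \<le> 0"
      using le[OF add_E[OF that(1) scale_E[OF that(2)]]] majorant_norm_nonpos[OF that(3)] by (rule order.trans)
    then show ?thesis
      using add[OF that(1) scale_E[OF that(2)], of "- 1"] scale[OF that(2), of "- 1"] by linarith
  qed
  have "\<phi> y = \<phi> z" if yz: "y \<in> E" "z \<in> E" and ae: "AE u in semiaxis. y u = z u" for y z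
  proof (rule antisym)
    have "AE u in semiaxis. y u + - 1 * z u = 0" using ae by eventually_elim simp
    then show "\<phi> y \<le> \<phi> z" by (intro diff_le yz dominated_null add_E scale_E)
    have "AE u in semiaxis. z u + - 1 * y u = 0" using ae by eventually_elim simp
    then show "\<phi> z \<le> \<phi> y" by (intro diff_le yz dominated_null add_E scale_E)
  qed
  moreover have "\<phi> y \<le> \<phi> z" if "z \<in> E" "y \<in> E" "AE u in semiaxis. 0 \<le> z u"
    "AE u in semiaxis. 0 \<le> y u" "y \<prec>\<prec> z" for y z
    by (intro diff_le dominated_diff that)
  ultimately have "fully_symmetric_functional E \<phi>"
    unfolding fully_symmetric_functional_def linear_functional_on_def using add scale by blast
  moreover have "N (contraction m x) = 1 / real m * N (dilation (real m) (rearrangement x))" if "0 < m" for m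
  proof -
    have "(\<lambda>t. real m * contraction m x t) = dilation (real m) (rearrangement x)"
      using that by (simp add: contraction_def fun_eq_iff)
    then show ?thesis
      using N_scale[OF contraction_E[OF assms(2) that], of "real m"] that by (simp add: field_simps)
  qed
  then have "(\<lambda>m. 1 / real m * N (dilation (real m) (rearrangement x))) \<longlonglongrightarrow> majorant_norm x"
    by (intro Lim_transform_eventually[OF contraction_norm_tendsto_majorant_norm[OF assms(2,3)]]
          eventually_sequentiallyI[of 1]) auto
  ultimately show ?thesis using eq by auto
qed

end
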